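(* If $\Sigma$ is a finite "CM$_{\mathbf Z}$" simplicial homology$_{\mathbf Z}$ $n$-manifold, then $\Sigma$ is orientable$_{\mathbf Z}$.
   Context: Simplicial complexes contain the empty simplex $\emptyset$ (dim $-1$) when nonempty. $\mathrm{cost}_\Sigma\sigma=\{\tau\in\Sigma:\sigma\not\subset\tau\}$. Augmental homology: reduced simplicial homology with $\emptyset$ in degree $-1$; relative homology ordinary for a nonempty subcomplex and reduced for the subcomplex $\emptyset$. Simplicial homology$_{\mathbf Z}$ $n$-manifold ($n=\dim\Sigma$): $\bullet\bullet$ (two vertices, no edge), $\{\emptyset\}$, or $|\Sigma|$ connected, locally compact, with $H_i(|\Sigma|,|\Sigma|\setminus\{x\};\mathbf Z)=0$ for $i\ne n$, $\cong0$ or $\mathbf Z$ for $i=n$, for all $x$, and $\cong\mathbf Z$ for some $x$. $\mathrm{Bd}_{\mathbf Z}\Sigma=\{\sigma:\mathbf H_n(\Sigma,\mathrm{cost}_\Sigma\sigma;\mathbf Z)=0\}$; finite $\Sigma$ is orientable$_{\mathbf Z}$ if $\mathbf H_n(\Sigma,\mathrm{Bd}_{\mathbf Z}\Sigma;\mathbf Z)\cong\mathbf Z$. "CM$_{\mathbf Z}$" for a complex of dimension $m$: $H_i(|\Sigma|,|\Sigma|\setminus\{x\};\mathbf Z)=0$ for all $i\ne m$ and all $x\in|\Sigma|$, reduced $\mathbf H_i(\Sigma;\mathbf Z)=0$ for $i\ne m$, and some local group in degree $m$ has $\mathbf Z$ as a direct summand. *)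

theory Defs
  imports "HOL-Analysis.Analysis" "HOL-Homology.Homology"
begin

text \<open>A simplicial complex is a set of finite vertex sets closed under subsets;
  when nonempty it contains the empty simplex.\<close>

definition simplicial_complex :: "'v set set \<Rightarrow> bool" where
  "simplicial_complex K \<longleftrightarrow> (\<forall>\<sigma>\<in>K. finite \<sigma>) \<and> (\<forall>\<sigma>\<in>K. \<forall>\<tau>. \<tau> \<subseteq> \<sigma> \<longrightarrow> \<tau> \<in> K)"

definition sdim :: "'v set set \<Rightarrow> int" where
  "sdim K = int (Max (card ` K)) - 1"

definition cost :: "'v set set \<Rightarrow> 'v set \<Rightarrow> 'v set set" where
  "cost K \<sigma> = {\<tau> \<in> K. \<not> \<sigma> \<subseteq> \<tau>}"

text \<open>Simplices are oriented by the linear order of the vertices. A p-chain of the pair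
  (K,L) is an integer function supported on simplices of K - L with p+1 vertices;
  the empty simplex sits in degree -1.\<close>

definition schain_group :: "int \<Rightarrow> 'v set set \<Rightarrow> 'v set set \<Rightarrow> ('v set \<Rightarrow> int) monoid" where
  "schain_group p K L =
     \<lparr>carrier = {c. \<forall>\<sigma>. c \<sigma> \<noteq> 0 \<longrightarrow> \<sigma> \<in> K - L \<and> int (card \<sigma>) = p + 1},
      monoid.mult = (\<lambda>c d \<sigma>. c \<sigma> + d \<sigma>),
      one = (\<lambda>\<sigma>. 0)\<rparr>"

text \<open>Relative boundary: the simplicial boundary followed by projection onto K - L.
  The face of insert v tau omitting v carries the sign (-1)^(number of vertices of tau below v).\<close>

definition sboundary :: "'v::linorder set set \<Rightarrow> 'v set set \<Rightarrow> ('v set \<Rightarrow> int) \<Rightarrow> ('v set \<Rightarrow> int)" where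
  "sboundary K L c = (\<lambda>\<tau>. if \<tau> \<in> K - L then
       (\<Sum>v\<in>{v. v \<notin> \<tau> \<and> insert v \<tau> \<in> K - L}. (-1) ^ card {w\<in>\<tau>. w < v} * c (insert v \<tau>))
     else 0)"

definition scycles :: "int \<Rightarrow> 'v::linorder set set \<Rightarrow> 'v set set \<Rightarrow> ('v set \<Rightarrow> int) set" where
  "scycles p K L = {c \<in> carrier (schain_group p K L). sboundary K L c = (\<lambda>\<sigma>. 0)}"

definition sboundaries :: "int \<Rightarrow> 'v::linorder set set \<Rightarrow> 'v set set \<Rightarrow> ('v set \<Rightarrow> int) set" where
  "sboundaries p K L = sboundary K L ` carrier (schain_group (p + 1) K L)"

text \<open>Augmental relative homology H_p(K,L;Z) (for L the void complex this is reduced homology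
  of K; for nonempty L it is ordinary relative homology).\<close>

definition aug_homology :: "int \<Rightarrow> 'v::linorder set set \<Rightarrow> 'v set set \<Rightarrow> ('v set \<Rightarrow> int) set monoid" where
  "aug_homology p K L = ((schain_group p K L)\<lparr>carrier := scycles p K L\<rparr>) Mod (sboundaries p K L)"

definition realization :: "'v set set \<Rightarrow> ('v \<Rightarrow> real) set" where
  "realization K = {f. (\<forall>v. 0 \<le> f v) \<and> {v. f v \<noteq> 0} \<in> K \<and> (\<Sum>v\<in>{v. f v \<noteq> 0}. f v) = 1}"

definition realtop :: "'v set set \<Rightarrow> ('v \<Rightarrow> real) topology" where
  "realtop K = subtopology (powertop_real UNIV) (realization K)"

abbreviation local_homology :: "int \<Rightarrow> 'v set set \<Rightarrow> ('v \<Rightarrow> real) \<Rightarrow> ('v \<Rightarrow> real) chain set monoid" where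
  "local_homology i K x \<equiv> relative_homology_group i (realtop K) (topspace (realtop K) - {x})"

definition homology_manifold :: "'v set set \<Rightarrow> bool" where
  "homology_manifold K \<longleftrightarrow>
     (\<exists>a b. a \<noteq> b \<and> K = {{}, {a}, {b}}) \<or> K = {{}} \<or>
     (connected_space (realtop K) \<and> locally_compact_space (realtop K) \<and>
      (\<forall>x\<in>topspace (realtop K).
         (\<forall>i. i \<noteq> sdim K \<longrightarrow> trivial_group (local_homology i K x)) \<and>
         (trivial_group (local_homology (sdim K) K x) \<or> local_homology (sdim K) K x \<cong> integer_group)) \<and>
      (\<exists>x\<in>topspace (realtop K). local_homology (sdim K) K x \<cong> integer_group))"

definition sboundary_complex :: "'v::linorder set set \<Rightarrow> 'v set set" where
  "sboundary_complex K = {\<sigma> \<in> K. trivial_group (aug_homology (sdim K) K (cost K \<sigma>))}"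

definition orientable :: "'v::linorder set set \<Rightarrow> bool" where
  "orientable K \<longleftrightarrow> aug_homology (sdim K) K (sboundary_complex K) \<cong> integer_group"

definition Z_direct_summand :: "('a, 'b) monoid_scheme \<Rightarrow> bool" where
  "Z_direct_summand G \<longleftrightarrow>
     (\<exists>A B. subgroup A G \<and> subgroup B G \<and> A \<inter> B = {\<one>\<^bsub>G\<^esub>} \<and> A <#>\<^bsub>G\<^esub> B = carrier G \<and>
            G\<lparr>carrier := A\<rparr> \<cong> integer_group)"

definition CM :: "'v::linorder set set \<Rightarrow> bool" where
  "CM K \<longleftrightarrow>
     (\<forall>x\<in>topspace (realtop K). \<forall>i. i \<noteq> sdim K \<longrightarrow> trivial_group (local_homology i K x)) \<and>
     (\<forall>i. i \<noteq> sdim K \<longrightarrow> trivial_group (aug_homology i K {})) \<and>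
     (\<exists>x\<in>topspace (realtop K). Z_direct_summand (local_homology (sdim K) K x))"

end

theory Submission
  imports Defs "HOL-Library.Z2"
begin

text \<open>
  The local conditions and the vanishing of reduced homology make every pair
  \<open>(K, cost \<sigma>)\<close> acyclic below the top degree, and every simplex of codimension one lies in at
  most two facets; everything needed about this is visible mod 2. From acyclicity a coherent orientation
  of the facets containing \<open>\<sigma>\<close> is built by downward induction on \<open>\<sigma>\<close>: orientations around
  the simplices \<open>insert v \<sigma>\<close> differ pairwise by signs which form a mod 2 cocycle, and this cocycle is a
  coboundary because \<open>H\<^sub>1\<close> of the link vanishes. For \<open>\<sigma> = {}\<close> this gives a generator
  of the top homology modulo the boundary, unique up to sign by strong connectedness.

  Passing from singular to simplicial homology only requires that a simplicial chain whose
  linear realization bounds in singular homology bounds simplicially. A Sperner labelling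
  turns small singular simplices into simplices of \<open>K\<close>, and by Sperner's lemma it sends
  a subdivided linear simplex back to the simplex itself.
\<close>

text \<open>Orientability asks for a consistent choice of signs, so its obstruction takes values in
  Z/2, and a ridge with too many facets already shows in H/2H for the top local group H. Passing to
  Z/2 frees the labelled image of a singular simplex from any orientation. The price is a universal
  coefficient step: mod 2 acyclicity in degree q is drawn from integral vanishing in degrees q and q
  - 1, which the hypotheses grant below the top degree.

  This limit on degrees shapes the induction. Gluing over \<open>\<sigma>\<close> uses H_1 of the
  link, which lies below the top degree only when the link has dimension at least two. If the link
  is a graph, H_1 is the top group and may be nonzero, since the link can be a circle; codimension
  two is therefore settled by counting vertices and edges, and in codimension one there are only two
  signs to compare.

  The empty simplex has no barycenter, so local homology says nothing about it. Its acyclicity comes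
  from the reduced homology of \<open>K\<close>, and for \<open>n = 0\<close> the bound on the
  number of facets comes from connectedness, or from inspection of the two-point complex.\<close>

text \<open>These rewrite sums and products of bits to bit operations, which blocks ring simplification.\<close>

declare add_bit_eq_xor [simp del] mult_bit_eq_and [simp del]

section \<open>Mod 2 chains\<close>

text \<open>A basis of the chains of the pair \<open>(K, cost K \<sigma>)\<close>. Grading by
  cardinality shifts every degree by one and puts the empty simplex in degree 0.\<close>

definition cofaces :: "'v set set \<Rightarrow> 'v set \<Rightarrow> nat \<Rightarrow> 'v set set" where
  "cofaces K \<sigma> k = {\<tau> \<in> K. \<sigma> \<subseteq> \<tau> \<and> card \<tau> = k}"

definition cofvs :: "'v set set \<Rightarrow> 'v set \<Rightarrow> 'v set" where
  "cofvs K \<tau> = {v. v \<notin> \<tau> \<and> insert v \<tau> \<in> K}"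

text \<open>At a face containing \<open>\<sigma>\<close> every \<open>insert v \<tau>\<close>
  contains \<open>\<sigma>\<close> too, so this one formula is the boundary of all the pairs
  \<open>(K, cost K \<sigma>)\<close> at once. Chains are arbitrary functions; only their values in
  the relevant cardinality matter.\<close>

definition bdry2 :: "'v set set \<Rightarrow> ('v set \<Rightarrow> bit) \<Rightarrow> 'v set \<Rightarrow> bit" where
  "bdry2 K c \<tau> = (\<Sum>v\<in>cofvs K \<tau>. c (insert v \<tau>))"

lemma bit_add_eq_0_iff: "a + b = 0 \<longleftrightarrow> a = b" for a b :: bit
  by (cases a; cases b) auto

lemma bit_add_self [simp]: "a + a = 0" for a :: bit
  by (cases a) auto

lemma bit_of_nat: "(of_nat m :: bit) = of_bool (odd m)"
  by (induction m) auto

lemma bit_of_int: "(of_int m :: bit) = of_bool (odd m)"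
  by (cases m) (auto simp: bit_of_nat)

lemma simplicial_complex_finite: "simplicial_complex K \<Longrightarrow> \<sigma> \<in> K \<Longrightarrow> finite \<sigma>"
  by (simp add: simplicial_complex_def)

lemma simplicial_complex_subset: "simplicial_complex K \<Longrightarrow> \<sigma> \<in> K \<Longrightarrow> \<tau> \<subseteq> \<sigma> \<Longrightarrow> \<tau> \<in> K"
  by (auto simp: simplicial_complex_def)

lemma finite_vertices: "simplicial_complex K \<Longrightarrow> finite K \<Longrightarrow> finite (\<Union>K)"
  by (simp add: simplicial_complex_finite)

lemma finite_cofvs: "simplicial_complex K \<Longrightarrow> finite K \<Longrightarrow> finite (cofvs K \<tau>)"
  by (rule finite_subset[OF _ finite_vertices]) (auto simp: cofvs_def)

lemma finite_cofaces: "finite K \<Longrightarrow> finite (cofaces K \<sigma> k)"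
  by (simp add: cofaces_def)

text \<open>Incident pairs of a face and a coface are counted from either end. On the right
  \<open>v\<close> stays outside \<open>\<sigma>\<close>, since removing a vertex of
  \<open>\<sigma>\<close> would leave its cofaces.\<close>

lemma sum_cofaces_swap:
  fixes g :: "'v set \<Rightarrow> 'v \<Rightarrow> 'a::comm_monoid_add"
  assumes "simplicial_complex K" "finite K"
  shows "(\<Sum>\<tau>\<in>cofaces K \<sigma> k. \<Sum>v\<in>cofvs K \<tau>. g \<tau> v)
       = (\<Sum>\<rho>\<in>cofaces K \<sigma> (Suc k). \<Sum>v\<in>\<rho>-\<sigma>. g (\<rho>-{v}) v)"
proof -
  have "(\<Sum>\<tau>\<in>cofaces K \<sigma> k. \<Sum>v\<in>cofvs K \<tau>. g \<tau> v)
      = (\<Sum>(\<tau>,v)\<in>Sigma (cofaces K \<sigma> k) (cofvs K). g \<tau> v)"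
    by (rule sum.Sigma) (auto simp: finite_cofaces finite_cofvs assms)
  also have "\<dots> = (\<Sum>(\<rho>,v)\<in>Sigma (cofaces K \<sigma> (Suc k)) (\<lambda>\<rho>. \<rho>-\<sigma>). g (\<rho>-{v}) v)"
    by (rule sum.reindex_bij_witness[where i="\<lambda>(\<rho>,v). (\<rho>-{v},v)" and j="\<lambda>(\<tau>,v). (insert v \<tau>,v)"])
       (use assms in \<open>auto simp: cofaces_def cofvs_def insert_absorb simplicial_complex_finite
          intro: simplicial_complex_subset\<close>)
  also have "\<dots> = (\<Sum>\<rho>\<in>cofaces K \<sigma> (Suc k). \<Sum>v\<in>\<rho>-\<sigma>. g (\<rho>-{v}) v)"
    by (rule sum.Sigma[symmetric])
       (use assms in \<open>auto simp: finite_cofaces cofaces_def dest: simplicial_complex_finite\<close>)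
  finally show ?thesis .
qed

text \<open>The inner sum on the right is the coboundary of \<open>h\<close> relative to
  \<open>\<sigma>\<close>, so this is the adjointness that turns vanishing homology into statements
  about cocycles.\<close>

lemma bdry2_adjoint:
  assumes "simplicial_complex K" "finite K"
  shows "(\<Sum>\<tau>\<in>cofaces K \<sigma> k. h \<tau> * bdry2 K u \<tau>)
       = (\<Sum>\<rho>\<in>cofaces K \<sigma> (Suc k). u \<rho> * (\<Sum>v\<in>\<rho>-\<sigma>. h (\<rho>-{v})))"
proof -
  have "(\<Sum>\<tau>\<in>cofaces K \<sigma> k. h \<tau> * bdry2 K u \<tau>)
      = (\<Sum>\<tau>\<in>cofaces K \<sigma> k. \<Sum>v\<in>cofvs K \<tau>. h \<tau> * u (insert v \<tau>))"
    by (simp add: bdry2_def sum_distrib_left)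
  also have "\<dots> = (\<Sum>\<rho>\<in>cofaces K \<sigma> (Suc k). \<Sum>v\<in>\<rho>-\<sigma>. h (\<rho>-{v}) * u (insert v (\<rho>-{v})))"
    by (rule sum_cofaces_swap[OF assms])
  also have "\<dots> = (\<Sum>\<rho>\<in>cofaces K \<sigma> (Suc k). u \<rho> * (\<Sum>v\<in>\<rho>-\<sigma>. h (\<rho>-{v})))"
    by (auto simp: sum_distrib_left insert_absorb mult.commute intro!: sum.cong)
  finally show ?thesis .
qed

lemma bdry2_single:
  assumes "simplicial_complex K" "finite K" "\<tau>1 \<in> K"
  shows "bdry2 K (\<lambda>\<tau>. of_bool (\<tau> = \<tau>1)) \<tau> = of_bool (\<tau> \<subseteq> \<tau>1 \<and> card \<tau>1 = Suc (card \<tau>))"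
proof (cases "\<tau> \<subseteq> \<tau>1 \<and> card \<tau>1 = Suc (card \<tau>)")
  case True
  have f: "finite \<tau>1" "finite \<tau>" using assms True simplicial_complex_finite infinite_super by blast+
  have "card (\<tau>1 - \<tau>) = 1" using True f by (simp add: card_Diff_subset)
  then obtain x where x: "\<tau>1 - \<tau> = {x}" by (meson card_1_singletonE)
  then have 1: "insert v \<tau> = \<tau>1 \<longleftrightarrow> v = x" if "v \<notin> \<tau>" for v
    using that True by auto
  have "bdry2 K (\<lambda>\<tau>. of_bool (\<tau> = \<tau>1)) \<tau> = (\<Sum>v\<in>cofvs K \<tau>. of_bool (v = x))"
    unfolding bdry2_def using 1 by (intro sum.cong) (auto simp: cofvs_def)
  also have "\<dots> = 1" using 1[of x] x assms
    by (subst sum.remove[OF finite_cofvs[OF assms(1,2)], of x]) (auto simp: cofvs_def)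
  finally show ?thesis using True by simp
next
  case False
  have "insert v \<tau> \<noteq> \<tau>1" if "v \<in> cofvs K \<tau>" for v
  proof
    assume "insert v \<tau> = \<tau>1"
    then have "finite \<tau>" using assms simplicial_complex_finite by fastforce
    then show False using that False \<open>insert v \<tau> = \<tau>1\<close> by (auto simp: cofvs_def)
  qed
  then show ?thesis using False by (auto simp: bdry2_def)
qed

lemma bdry2_add: "bdry2 K (\<lambda>\<tau>. a \<tau> + b \<tau>) \<tau> = bdry2 K a \<tau> + bdry2 K b \<tau>"
  by (simp add: bdry2_def sum.distrib)

section \<open>Coherent orientations of acyclic pseudomanifolds\<close>

text \<open>The assumption \<open>acyclic\<close> is the vanishing of the mod 2 homology of
  \<open>(K, cost K \<sigma>)\<close> in degree \<open>k - 1\<close>, hence in all degrees below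
  \<open>n\<close>. For \<open>\<sigma> = {}\<close> this is reduced homology.\<close>

locale mod2_acyclic =
  fixes K :: "'v set set" and n :: nat
  assumes complex: "simplicial_complex K" and fin: "finite K"
    and card_le: "\<sigma> \<in> K \<Longrightarrow> card \<sigma> \<le> Suc n"
    and acyclic: "\<lbrakk>\<sigma> \<in> K; k \<le> n; \<And>\<tau>. \<lbrakk>\<tau> \<in> K; \<sigma> \<subseteq> \<tau>; Suc (card \<tau>) = k\<rbrakk> \<Longrightarrow> bdry2 K z \<tau> = 0\<rbrakk>
       \<Longrightarrow> \<exists>u. \<forall>\<tau>\<in>cofaces K \<sigma> k. bdry2 K u \<tau> = z \<tau>"
begin

lemma finite_simplex: "\<sigma> \<in> K \<Longrightarrow> finite \<sigma>"
  using complex simplicial_complex_finite by blast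

lemma face: "\<sigma> \<in> K \<Longrightarrow> \<tau> \<subseteq> \<sigma> \<Longrightarrow> \<tau> \<in> K"
  using complex simplicial_complex_subset by blast

text \<open>Purity is acyclicity in the lowest degree: relative to its cost \<open>\<sigma>\<close>
  is a cycle on its own, so below the top dimension it bounds and must have a proper coface.\<close>

lemma facet_exists: "\<sigma> \<in> K \<Longrightarrow> \<exists>F. F \<in> cofaces K \<sigma> (Suc n)"
proof (induction "Suc n - card \<sigma>" arbitrary: \<sigma>)
  case 0
  then show ?case using card_le[of \<sigma>] by (auto simp: cofaces_def)
next
  case (Suc m)
  have False if "\<tau> \<in> K" "\<sigma> \<subseteq> \<tau>" "Suc (card \<tau>) = card \<sigma>" for \<tau>
    using that card_mono[of \<tau> \<sigma>] finite_simplex by auto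
  moreover have "card \<sigma> \<le> n" using Suc(2) by linarith
  ultimately obtain u where "\<forall>\<tau>\<in>cofaces K \<sigma> (card \<sigma>). bdry2 K u \<tau> = 1"
    using acyclic[OF Suc(3), of "card \<sigma>" "\<lambda>_. 1"] by blast
  then have "bdry2 K u \<sigma> = 1" using Suc(3) by (auto simp: cofaces_def)
  then have "cofvs K \<sigma> \<noteq> {}" by (auto simp: bdry2_def)
  then obtain v where v: "v \<notin> \<sigma>" "insert v \<sigma> \<in> K" by (auto simp: cofvs_def)
  have "m = Suc n - card (insert v \<sigma>)" using v Suc(2,3) finite_simplex[of \<sigma>] by simp
  from Suc(1)[OF this v(2)] show ?case by (auto simp: cofaces_def)
qed

text \<open>The cycle bounds, and a cocycle pairs to zero with every boundary. Feeding in
  well-chosen cycles later shows that a cocycle is constant or a coboundary.\<close>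

lemma cocycle_annihilates_cycle:
  assumes "\<sigma> \<in> K" "k \<le> n" "\<And>\<tau>. \<lbrakk>\<tau> \<in> K; \<sigma> \<subseteq> \<tau>; Suc (card \<tau>) = k\<rbrakk> \<Longrightarrow> bdry2 K z \<tau> = 0"
    and "\<And>\<rho>. \<rho> \<in> cofaces K \<sigma> (Suc k) \<Longrightarrow> (\<Sum>v\<in>\<rho>-\<sigma>. h (\<rho>-{v})) = 0"
  shows "(\<Sum>\<tau>\<in>cofaces K \<sigma> k. h \<tau> * z \<tau>) = 0"
proof -
  obtain u where "\<forall>\<tau>\<in>cofaces K \<sigma> k. bdry2 K u \<tau> = z \<tau>"
    using acyclic[of \<sigma> k z] assms by blast
  then have "(\<Sum>\<tau>\<in>cofaces K \<sigma> k. h \<tau> * z \<tau>) = (\<Sum>\<tau>\<in>cofaces K \<sigma> k. h \<tau> * bdry2 K u \<tau>)"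
    by simp
  then show ?thesis by (simp add: bdry2_adjoint[OF complex fin] assms(4))
qed

lemma coface_card_eq:
  assumes "\<tau> \<in> K" "\<sigma> \<subseteq> \<tau>" "card \<tau> = card \<sigma>" shows "\<tau> = \<sigma>"
  using assms card_subset_eq finite_simplex by metis

text \<open>Strong connectedness of the star of \<open>\<sigma>\<close>, phrased through functions
  instead of paths of facets so that it becomes cohomological: by induction \<open>f\<close>
  descends to the vertices of the link as a 0-cocycle, which is constant because the reduced degree
  0 homology of the link vanishes. If \<open>card \<sigma> = n\<close>, any two distinct facets are
  adjacent.\<close>

lemma facets_constant_bit:
  fixes f :: "'v set \<Rightarrow> bit"
  assumes "\<sigma> \<in> K"
    and "\<And>F F'. \<lbrakk>F \<in> cofaces K \<sigma> (Suc n); F' \<in> cofaces K \<sigma> (Suc n); card (F \<inter> F') = n\<rbrakk> \<Longrightarrow> f F = f F'"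
    and "F1 \<in> cofaces K \<sigma> (Suc n)" "F2 \<in> cofaces K \<sigma> (Suc n)"
  shows "f F1 = f F2"
  using assms
proof (induction "Suc n - card \<sigma>" arbitrary: \<sigma> F1 F2)
  case 0
  then have "card \<sigma> = Suc n"
    using card_le[of \<sigma>] by linarith
  then have "F1 = \<sigma>" "F2 = \<sigma>"
    using 0(4,5) coface_card_eq by (simp_all add: cofaces_def)
  then show ?case by simp
next
  case (Suc m)
  note adj = Suc.prems(2)
  consider "card \<sigma> = n" | "card \<sigma> < n" using Suc(2) by linarith
  then show ?case
  proof cases
    case 1
    show ?thesis
    proof (cases "F1 = F2")
      case False
      have F: "F1 \<in> K" "F2 \<in> K" "finite F1" "finite F2" "card F1 = Suc n" "card F2 = Suc n" "\<sigma> \<subseteq> F1 \<inter> F2"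
        using Suc.prems(3,4) finite_simplex by (auto simp: cofaces_def)
      then have "card \<sigma> \<le> card (F1 \<inter> F2)" by (intro card_mono) auto
      moreover have "card (F1 \<inter> F2) < Suc n"
      proof -
        have "F1 \<inter> F2 \<subset> F1" using False F by (metis card_subset_eq inf_le1 inf_le2 psubsetI inf.absorb_iff1)
        then show ?thesis using psubset_card_mono[of F1] F by metis
      qed
      ultimately have "card (F1 \<inter> F2) = n" using 1 by linarith
      then show ?thesis using Suc.prems(3,4) adj by blast
    qed simp
  next
    case 2
    let ?k = "Suc (card \<sigma>)"
    \<comment> \<open>By induction \<open>f\<close> is constant on the facets through
      \<open>\<tau>\<close>, so the chosen facet is immaterial.\<close>
    define h where "h \<tau> = f (SOME F. F \<in> cofaces K \<tau> (Suc n))" for \<tau>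
    have h: "h \<tau> = f F" if "\<tau> \<in> cofaces K \<sigma> ?k" "F \<in> cofaces K \<tau> (Suc n)" for \<tau> F
    proof -
      have \<tau>: "\<tau> \<in> K" "\<sigma> \<subseteq> \<tau>" "card \<tau> = ?k" using that by (auto simp: cofaces_def)
      then have m: "m = Suc n - card \<tau>" using Suc(2) by simp
      have "(SOME F. F \<in> cofaces K \<tau> (Suc n)) \<in> cofaces K \<tau> (Suc n)"
        using that(2) by (rule someI)
      moreover have "cofaces K \<tau> (Suc n) \<subseteq> cofaces K \<sigma> (Suc n)"
        using \<tau> by (auto simp: cofaces_def)
      ultimately show ?thesis unfolding h_def
        using Suc(1)[OF m \<tau>(1)] adj that(2) by (metis subsetD)
    qed
    have cocycle: "(\<Sum>v\<in>\<rho>-\<sigma>. h (\<rho>-{v})) = 0" if "\<rho> \<in> cofaces K \<sigma> (Suc ?k)" for \<rho>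
    proof -
      have \<rho>: "\<rho> \<in> K" "\<sigma> \<subseteq> \<rho>" "card \<rho> = Suc ?k" using that by (auto simp: cofaces_def)
      then obtain G where "G \<in> cofaces K \<rho> (Suc n)" using facet_exists by blast
      then have "h (\<rho>-{v}) = f G" if "v \<in> \<rho>-\<sigma>" for v
        using that \<rho> finite_simplex[of \<rho>] face[of \<rho>] by (intro h) (auto simp: cofaces_def)
      then have "(\<Sum>v\<in>\<rho>-\<sigma>. h (\<rho>-{v})) = of_nat (card (\<rho>-\<sigma>)) * f G" by simp
      moreover have "card (\<rho>-\<sigma>) = 2"
        using \<rho> finite_simplex[of \<sigma>] Suc.prems(1) by (simp add: card_Diff_subset)
      ultimately show ?thesis by simp
    qed
    have eq: "h \<tau>1 = h \<tau>2" if \<tau>: "\<tau>1 \<in> cofaces K \<sigma> ?k" "\<tau>2 \<in> cofaces K \<sigma> ?k" for \<tau>1 \<tau>2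
    proof -
      \<comment> \<open>Two vertices of the link together have even augmentation, so
        \<open>z\<close> is a reduced cycle; pairing it with \<open>h\<close> compares the two
        values.\<close>
      define z :: "'v set \<Rightarrow> bit" where "z \<tau> = of_bool (\<tau> = \<tau>1) + of_bool (\<tau> = \<tau>2)" for \<tau>
      have "bdry2 K z \<tau> = 0" if "\<tau> \<in> K" "\<sigma> \<subseteq> \<tau>" "Suc (card \<tau>) = ?k" for \<tau>
      proof -
        have "\<tau> = \<sigma>" using that coface_card_eq by auto
        then show ?thesis unfolding z_def bdry2_add using \<tau>
          by (simp add: bdry2_single complex fin cofaces_def)
      qed
      then have "(\<Sum>\<tau>\<in>cofaces K \<sigma> ?k. h \<tau> * z \<tau>) = 0"
        using cocycle 2 Suc.prems(1) by (intro cocycle_annihilates_cycle) auto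
      moreover have "(\<Sum>\<tau>\<in>cofaces K \<sigma> ?k. h \<tau> * of_bool (\<tau> = \<tau>')) = h \<tau>'" if "\<tau>' \<in> cofaces K \<sigma> ?k" for \<tau>'
        using that by (subst sum.remove[of _ \<tau>']) (auto simp: finite_cofaces fin intro!: sum.neutral)
      ultimately have "h \<tau>1 + h \<tau>2 = 0"
        using \<tau> by (simp add: z_def distrib_left sum.distrib)
      then show ?thesis by (simp only: bit_add_eq_0_iff)
    qed
    have "\<exists>\<tau>\<in>cofaces K \<sigma> ?k. F \<in> cofaces K \<tau> (Suc n)" if "F \<in> cofaces K \<sigma> (Suc n)" for F
    proof -
      have F: "F \<in> K" "\<sigma> \<subseteq> F" "card F = Suc n" using that by (auto simp: cofaces_def)
      then have "\<sigma> \<noteq> F" using 2 by auto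
      then obtain v where "v \<in> F" "v \<notin> \<sigma>" using F by auto
      then show ?thesis using F face[of F "insert v \<sigma>"] finite_simplex[of \<sigma>] Suc.prems(1)
        by (intro bexI[of _ "insert v \<sigma>"]) (auto simp: cofaces_def)
    qed
    then show ?thesis using Suc.prems(3,4) h eq by metis
  qed
qed

text \<open>Values of any type reduce to bits through the indicator of the value at
  \<open>F1\<close>.\<close>

lemma facets_constant:
  assumes "\<sigma> \<in> K"
    and "\<And>F F'. \<lbrakk>F \<in> cofaces K \<sigma> (Suc n); F' \<in> cofaces K \<sigma> (Suc n); card (F \<inter> F') = n\<rbrakk> \<Longrightarrow> f F = f F'"
    and "F1 \<in> cofaces K \<sigma> (Suc n)" "F2 \<in> cofaces K \<sigma> (Suc n)"
  shows "f F1 = f F2"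
proof -
  have "(of_bool (f F1 = f F1) :: bit) = of_bool (f F2 = f F1)"
    by (rule facets_constant_bit[OF assms(1) _ assms(3,4)]) (metis assms(2))
  then show ?thesis by (auto split: if_splits simp: of_bool_def)
qed

end


section \<open>Incidence signs as bits and the gluing of local orientations\<close>

definition vpos :: "'v::linorder set \<Rightarrow> 'v \<Rightarrow> bit" where
  "vpos R v = of_nat (card {w\<in>R. w < v})"

text \<open>With \<open>\<epsilon>\<close> and \<open>vpos\<close> read as exponents of -1, the
  facet \<open>insert v R\<close> contributes the sign with exponent
  \<open>\<epsilon> (insert v R) + vpos R v\<close> to the boundary at \<open>R\<close>. Two
  contributions cancel exactly when these exponents differ, which is the equation stated here for
  the ridges around \<open>\<sigma>\<close>.\<close>

definition coherent :: "'v::linorder set set \<Rightarrow> nat \<Rightarrow> 'v set \<Rightarrow> ('v set \<Rightarrow> bit) \<Rightarrow> bool" where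
  "coherent K n \<sigma> \<epsilon> \<longleftrightarrow> (\<forall>R\<in>cofaces K \<sigma> n. \<forall>v\<in>cofvs K R. \<forall>w\<in>cofvs K R. v \<noteq> w \<longrightarrow>
     \<epsilon> (insert v R) + \<epsilon> (insert w R) = 1 + vpos R v + vpos R w)"

lemma vpos_insert:
  assumes "finite R" "u \<notin> R" shows "vpos (insert u R) v = vpos R v + of_bool (u < v)"
proof -
  have "{w \<in> insert u R. w < v} = (if u < v then insert u {w\<in>R. w < v} else {w\<in>R. w < v})" by auto
  then show ?thesis using assms by (simp add: vpos_def)
qed

lemma card_le_2_cases:
  assumes "finite A" "card A \<le> 2" "a \<in> A" "b \<in> A" "a \<noteq> b" shows "A = {a,b}"
  using assms by (metis bot_least card_2_iff card_seteq empty_subsetI insert_subset)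

locale mod2_pseudomanifold = mod2_acyclic K n for K :: "'v::linorder set set" and n +
  assumes ridge: "\<lbrakk>R \<in> K; card R = n\<rbrakk> \<Longrightarrow> card (cofvs K R) \<le> 2"
begin

lemma cofvs_eq:
  assumes "R \<in> K" "card R = n" "v \<in> cofvs K R" "w \<in> cofvs K R" "v \<noteq> w"
  shows "cofvs K R = {v,w}"
  using assms ridge finite_cofvs[OF complex fin] by (intro card_le_2_cases) auto

lemma ridge_cofvs_nonempty:
  assumes "R \<in> K" "card R = n" shows "cofvs K R \<noteq> {}"
proof -
  obtain F where F: "F \<in> K" "R \<subseteq> F" "card F = Suc n"
    using facet_exists[OF assms(1)] by (auto simp: cofaces_def)
  moreover from F assms have "R \<noteq> F" by auto
  ultimately obtain v where "v \<in> F" "v \<notin> R" by blast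
  then have "v \<in> cofvs K R" using F face[of F "insert v R"] by (auto simp: cofvs_def)
  then show ?thesis by auto
qed

lemma coherent_exists_ridge:
  assumes "\<sigma> \<in> K" "card \<sigma> = n" shows "\<exists>\<epsilon>. coherent K n \<sigma> \<epsilon>"
proof (cases "\<exists>a\<in>cofvs K \<sigma>. \<exists>b\<in>cofvs K \<sigma>. a \<noteq> b")
  case True
  then obtain a b where ab: "a \<in> cofvs K \<sigma>" "b \<in> cofvs K \<sigma>" "a \<noteq> b" by blast
  then have eq: "cofvs K \<sigma> = {a,b}" using cofvs_eq assms by blast
  have ne: "insert b \<sigma> \<noteq> insert a \<sigma>" using ab by (auto simp: cofvs_def)
  have "coherent K n \<sigma> (\<lambda>F. if F = insert a \<sigma> then 1 + vpos \<sigma> a + vpos \<sigma> b else 0)"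
    unfolding coherent_def
  proof (intro ballI impI)
    fix R v w assume "R \<in> cofaces K \<sigma> n" "v \<in> cofvs K R" "w \<in> cofvs K R" "v \<noteq> w"
    moreover from this have "R = \<sigma>" using assms coface_card_eq by (auto simp: cofaces_def)
    ultimately have "R = \<sigma>" "v = a \<and> w = b \<or> v = b \<and> w = a" using eq by auto
    then show "(if insert v R = insert a \<sigma> then 1 + vpos \<sigma> a + vpos \<sigma> b else 0) +
       (if insert w R = insert a \<sigma> then 1 + vpos \<sigma> a + vpos \<sigma> b else 0) = 1 + vpos R v + vpos R w"
      using ne by (auto simp: add_ac)
  qed
  then show ?thesis by blast
next
  case False
  then have "coherent K n \<sigma> (\<lambda>_. 0)"
    unfolding coherent_def using assms coface_card_eq by (auto simp: cofaces_def)
  then show ?thesis by blast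
qed

text \<open>
  The coherence condition prescribes the mod 2 boundary of \<open>\<epsilon>\<close> on the ridges with two cofaces.
  The prescription extends to a cycle: if some ridge has a single coface its value there is free,
  and otherwise the sum vanishes since the link of \<open>\<sigma>\<close> has as many vertices as edges.
\<close>

lemma coherent_exists_codim2:
  assumes \<sigma>: "\<sigma> \<in> K" "Suc (card \<sigma>) = n" shows "\<exists>\<epsilon>. coherent K n \<sigma> \<epsilon>"
proof -
  let ?R = "cofaces K \<sigma> n" and ?F = "cofaces K \<sigma> (Suc n)"
  \<comment> \<open>If \<open>cofvs K R = {v,w}\<close>, this is the value that coherence prescribes
    for \<open>bdry2 K \<epsilon> R\<close>.\<close>
  define \<theta> where "\<theta> R = 1 + (\<Sum>v\<in>cofvs K R. vpos R v)" for R
  have inj: "card R = n" "finite R" "R \<in> K" "\<sigma> \<subseteq> R" if "R \<in> ?R" for R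
    using that finite_simplex by (auto simp: cofaces_def)
  have "\<exists>\<theta>'. (\<forall>R\<in>?R. card (cofvs K R) = 2 \<longrightarrow> \<theta>' R = \<theta> R) \<and> (\<Sum>R\<in>?R. \<theta>' R) = 0"
  proof (cases "\<exists>R\<in>?R. card (cofvs K R) \<noteq> 2")
    case True
    then obtain R0 where R0: "R0 \<in> ?R" "card (cofvs K R0) \<noteq> 2" by blast
    \<comment> \<open>The value at \<open>R0\<close> is unconstrained and is set to the sum of all
      the others, which makes the total even.\<close>
    have "(\<Sum>R\<in>?R. (\<theta>(R0 := \<Sum>R\<in>?R-{R0}. \<theta> R)) R) = (\<Sum>R\<in>?R-{R0}. \<theta> R) + (\<Sum>R\<in>?R-{R0}. \<theta> R)"
      using R0 by (subst sum.remove[of _ R0]) (auto simp: finite_cofaces fin)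
    then show ?thesis using R0 by (intro exI[of _ "\<theta>(R0 := \<Sum>R\<in>?R-{R0}. \<theta> R)"]) auto
  next
    case False
    then have two: "card (cofvs K R) = 2" if "R \<in> ?R" for R using that by auto
    have F2: "card (F - \<sigma>) = 2" if "F \<in> ?F" for F
      using that \<sigma> finite_simplex by (auto simp: cofaces_def card_Diff_subset)
    define q where "q R = (\<Sum>x\<in>R-\<sigma>. vpos \<sigma> x)" for R
    \<comment> \<open>Of the two vertices added to \<open>\<sigma>\<close> the larger one gains the
      smaller as a predecessor, so each edge of the link contributes 1. The \<open>q\<close> terms
      occur twice at each ridge and cancel after the swap.\<close>
    have pair: "(\<Sum>v\<in>F-\<sigma>. vpos (F-{v}) v) = 1 + (\<Sum>v\<in>F-\<sigma>. q (F-{v}))" if FF: "F \<in> ?F" for F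
    proof -
      have F: "F \<in> K" "\<sigma> \<subseteq> F" "card F = Suc n" using FF by (auto simp: cofaces_def)
      obtain a b where ab: "F - \<sigma> = {a,b}" "a < b"
        using F2[OF FF] by (metis card_2_iff insert_commute linorder_neqE)
      then have eq: "F = insert a (insert b \<sigma>)" "a \<notin> \<sigma>" "b \<notin> \<sigma>" "a \<noteq> b" using F(2) by auto
      then have eq2: "F - {a} = insert b \<sigma>" "F - {b} = insert a \<sigma>" by auto
      have fs: "finite \<sigma>" using \<sigma> finite_simplex by auto
      have "insert b \<sigma> - \<sigma> = {b}" "insert a \<sigma> - \<sigma> = {a}" using eq by auto
      then show ?thesis
        unfolding ab(1) using ab(2) eq(2,3,4) fs by (simp add: eq2 vpos_insert q_def add_ac)
    qed
    have "(\<Sum>R\<in>?R. \<Sum>v\<in>cofvs K R. vpos R v) = (\<Sum>F\<in>?F. \<Sum>v\<in>F-\<sigma>. vpos (F-{v}) v)"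
      by (rule sum_cofaces_swap[OF complex fin])
    also have "\<dots> = (\<Sum>F\<in>?F. 1) + (\<Sum>F\<in>?F. \<Sum>v\<in>F-\<sigma>. q (F-{v}))"
      by (simp add: pair sum.distrib)
    also have "(\<Sum>F\<in>?F. \<Sum>v\<in>F-\<sigma>. q (F-{v})) = (\<Sum>R\<in>?R. \<Sum>v\<in>cofvs K R. q R)"
      by (rule sum_cofaces_swap[OF complex fin, symmetric])
    also have "\<dots> = 0" using two by simp
    finally have 1: "(\<Sum>R\<in>?R. \<Sum>v\<in>cofvs K R. vpos R v) = of_nat (card ?F)" by simp
    \<comment> \<open>Every vertex of the link has two edges and every edge two vertices, so the
      numbers agree and the total of \<open>\<theta>\<close>, namely
      \<open>card ?R + card ?F\<close>, is even.\<close>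
    have "(\<Sum>R\<in>?R. \<Sum>v\<in>cofvs K R. 1::nat) = (\<Sum>F\<in>?F. \<Sum>v\<in>F-\<sigma>. 1)"
      by (rule sum_cofaces_swap[OF complex fin])
    then have "card ?R = card ?F" using two F2 by simp
    then have "(\<Sum>R\<in>?R. \<theta> R) = 0" using 1 by (simp add: \<theta>_def sum.distrib)
    then show ?thesis by blast
  qed
  then obtain \<theta>' where \<theta>': "\<And>R. R \<in> ?R \<Longrightarrow> card (cofvs K R) = 2 \<Longrightarrow> \<theta>' R = \<theta> R" "(\<Sum>R\<in>?R. \<theta>' R) = 0"
    by blast
  \<comment> \<open>The only face to test is \<open>\<sigma>\<close>, where the boundary is the
    total of \<open>\<theta>'\<close> over all ridges; an even total is the whole cycle
    condition.\<close>
  have "bdry2 K \<theta>' \<tau> = 0" if "\<tau> \<in> K" "\<sigma> \<subseteq> \<tau>" "Suc (card \<tau>) = n" for \<tau>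
  proof -
    have "\<tau> = \<sigma>" using that coface_card_eq \<sigma> by auto
    have "bij_betw (\<lambda>v. insert v \<sigma>) (cofvs K \<sigma>) ?R"
    proof (intro bij_betw_imageI)
      show "inj_on (\<lambda>v. insert v \<sigma>) (cofvs K \<sigma>)" by (auto simp: inj_on_def cofvs_def)
      have "R \<in> (\<lambda>v. insert v \<sigma>) ` cofvs K \<sigma>" if "R \<in> ?R" for R
      proof -
        have "card (R - \<sigma>) = 1" using inj[OF that] \<sigma> finite_simplex[of \<sigma>] by (simp add: card_Diff_subset)
        then obtain x where "R - \<sigma> = {x}" by (meson card_1_singletonE)
        then have "x \<notin> \<sigma>" "R = insert x \<sigma>" using inj[OF that] by auto
        then show ?thesis using inj[OF that] by (auto simp: cofvs_def)
      qed
      then show "(\<lambda>v. insert v \<sigma>) ` cofvs K \<sigma> = ?R"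
        using \<sigma> finite_simplex by (auto simp: cofaces_def cofvs_def)
    qed
    then have "bdry2 K \<theta>' \<sigma> = (\<Sum>R\<in>?R. \<theta>' R)" unfolding bdry2_def by (rule sum.reindex_bij_betw)
    then show ?thesis using \<theta>'(2) \<open>\<tau> = \<sigma>\<close> by simp
  qed
  then obtain \<epsilon> where \<epsilon>: "\<forall>R\<in>?R. bdry2 K \<epsilon> R = \<theta>' R"
    using acyclic[OF \<sigma>(1), of n \<theta>'] by blast
  have "coherent K n \<sigma> \<epsilon>" unfolding coherent_def
  proof (intro ballI impI)
    fix R v w assume R: "R \<in> ?R" "v \<in> cofvs K R" "w \<in> cofvs K R" "v \<noteq> w"
    then have eq: "cofvs K R = {v,w}" using cofvs_eq inj by blast
    then have "\<epsilon> (insert v R) + \<epsilon> (insert w R) = \<theta>' R" using \<epsilon> R(1,4) by (auto simp: bdry2_def)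
    also have "\<dots> = \<theta> R" using R eq by (intro \<theta>') auto
    finally show "\<epsilon> (insert v R) + \<epsilon> (insert w R) = 1 + vpos R v + vpos R w"
      using eq R(4) by (simp add: \<theta>_def add_ac)
  qed
  then show ?thesis by blast
qed

text \<open>The induction is on the codimension of \<open>\<sigma>\<close>. The gluing case needs
  \<open>card \<sigma> + 2 \<le> n\<close>, so that cardinality \<open>Suc ?k\<close>, the edges of
  the link, is still within the range of \<open>acyclic\<close>.\<close>

lemma coherent_exists: "\<sigma> \<in> K \<Longrightarrow> card \<sigma> \<le> n \<Longrightarrow> \<exists>\<epsilon>. coherent K n \<sigma> \<epsilon>"
proof (induction "n - card \<sigma>" arbitrary: \<sigma> rule: less_induct)
  case less
  note \<sigma> = less.prems(1)
  consider "card \<sigma> = n" | "Suc (card \<sigma>) = n" | "Suc (Suc (card \<sigma>)) \<le> n" using less.prems(2) by linarith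
  then show ?case
  proof cases
    case 1 then show ?thesis using coherent_exists_ridge less.prems by blast
  next
    case 2 then show ?thesis using coherent_exists_codim2 less.prems by blast
  next
    case 3
    let ?k = "Suc (card \<sigma>)"
    let ?V = "cofaces K \<sigma> ?k"
    have fs: "finite \<sigma>" using \<sigma> finite_simplex by auto
    have V: "\<tau> \<in> K" "\<sigma> \<subseteq> \<tau>" "card \<tau> = ?k" if "\<tau> \<in> ?V" for \<tau> using that by (auto simp: cofaces_def)
    have "\<exists>\<epsilon>. coherent K n \<tau> \<epsilon>" if "\<tau> \<in> ?V" for \<tau>
      using less.hyps[of \<tau>] V[OF that] 3 by simp
    then obtain e where e: "coherent K n \<tau> (e \<tau>)" if "\<tau> \<in> ?V" for \<tau> by metis
    have Vex: "\<tau> - {v} \<in> cofaces K \<sigma> j" if "\<tau> \<in> cofaces K \<sigma> (Suc j)" "v \<in> \<tau> - \<sigma>" for \<tau> v j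
      using that finite_simplex face[of \<tau> "\<tau>-{v}"] by (auto simp: cofaces_def)
    \<comment> \<open>Both orientations are coherent, so they jump by the same amount across each
      ridge of the common star, and their difference is constant there by strong
      connectedness.\<close>
    have const: "e \<tau> F + e \<tau>' F = e \<tau> F' + e \<tau>' F'"
      if \<tau>: "\<tau> \<in> ?V" "\<tau>' \<in> ?V" "\<tau> \<union> \<tau>' \<in> K"
        and F: "F \<in> cofaces K (\<tau> \<union> \<tau>') (Suc n)" "F' \<in> cofaces K (\<tau> \<union> \<tau>') (Suc n)" for \<tau> \<tau>' F F'
    proof (rule facets_constant[OF \<tau>(3) _ F])
      fix F F' assume F: "F \<in> cofaces K (\<tau> \<union> \<tau>') (Suc n)" "F' \<in> cofaces K (\<tau> \<union> \<tau>') (Suc n)"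
        and adj: "card (F \<inter> F') = n"
      let ?R = "F \<inter> F'"
      have F': "F \<in> K" "F' \<in> K" "card F = Suc n" "card F' = Suc n" "finite F" "finite F'"
        "\<tau> \<subseteq> ?R" "\<tau>' \<subseteq> ?R" using F finite_simplex by (auto simp: cofaces_def)
      then have R: "?R \<in> cofaces K \<tau> n" "?R \<in> cofaces K \<tau>' n"
        using adj face[of F ?R] by (auto simp: cofaces_def)
      have "card (F - ?R) = 1" "card (F' - ?R) = 1"
        using F' adj card_Diff_subset[of ?R F] card_Diff_subset[of ?R F'] by auto
      then obtain v w where v: "F - ?R = {v}" and w: "F' - ?R = {w}" by (metis card_1_singletonE)
      then have vw: "insert v ?R = F" "insert w ?R = F'" "v \<notin> ?R" "w \<notin> ?R" "v \<noteq> w" by auto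
      then have A: "v \<in> cofvs K ?R" "w \<in> cofvs K ?R" using F' unfolding cofvs_def by simp_all
      have *: "e t F + e t F' = 1 + vpos ?R v + vpos ?R w" if "t \<in> ?V" "?R \<in> cofaces K t n" for t
        using e[OF that(1), unfolded coherent_def, rule_format, OF that(2) A vw(5)] by (simp only: vw(1,2))
      have "e \<tau> F + e \<tau> F' = e \<tau>' F + e \<tau>' F'" using *[OF \<tau>(1) R(1)] *[OF \<tau>(2) R(2)] by simp
      then show "e \<tau> F + e \<tau>' F = e \<tau> F' + e \<tau>' F'"
        by (cases "e \<tau> F"; cases "e \<tau> F'"; cases "e \<tau>' F"; cases "e \<tau>' F'") auto
    qed
    \<comment> \<open>The discrepancy, along the edge \<open>\<rho>\<close> of the link, of the two
      local orientations at its ends; \<open>const\<close> makes it independent of the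
      facet.\<close>
    define g where "g \<rho> = (let F = SOME F. F \<in> cofaces K \<rho> (Suc n) in \<Sum>v\<in>\<rho>-\<sigma>. e (\<rho>-{v}) F)" for \<rho>
    have two: "\<exists>a b. a \<noteq> b \<and> \<rho> - \<sigma> = {a,b}" if "\<rho> \<in> cofaces K \<sigma> (Suc ?k)" for \<rho>
    proof -
      have "card (\<rho> - \<sigma>) = 2" using that fs by (auto simp: cofaces_def card_Diff_subset)
      then show ?thesis by (metis card_2_iff)
    qed
    have g: "g \<rho> = (\<Sum>v\<in>\<rho>-\<sigma>. e (\<rho>-{v}) F)"
      if \<rho>: "\<rho> \<in> cofaces K \<sigma> (Suc ?k)" and F: "F \<in> cofaces K \<rho> (Suc n)" for \<rho> F
    proof -
      obtain a b where ab: "a \<noteq> b" "\<rho> - \<sigma> = {a,b}" using two[OF \<rho>] by blast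
      let ?G = "SOME F. F \<in> cofaces K \<rho> (Suc n)"
      have G: "?G \<in> cofaces K \<rho> (Suc n)" using F by (rule someI)
      have un: "(\<rho>-{a}) \<union> (\<rho>-{b}) = \<rho>" using ab by auto
      have "e (\<rho>-{a}) ?G + e (\<rho>-{b}) ?G = e (\<rho>-{a}) F + e (\<rho>-{b}) F"
        using ab \<rho> F G un by (intro const Vex) (auto simp: cofaces_def)
      then show ?thesis using ab by (simp add: g_def Let_def)
    qed
    \<comment> \<open>A single facet over the triangle \<open>\<pi>\<close> evaluates all three
      edges, and then each of the three local orientations enters twice.\<close>
    have gcoc: "(\<Sum>v\<in>\<pi>-\<sigma>. g (\<pi>-{v})) = 0" if \<pi>: "\<pi> \<in> cofaces K \<sigma> (Suc (Suc ?k))" for \<pi>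
    proof -
      obtain F where F: "F \<in> cofaces K \<pi> (Suc n)" using facet_exists[of \<pi>] \<pi> cofaces_def[of K \<sigma>] by blast
      have "(\<Sum>v\<in>\<pi>-\<sigma>. g (\<pi>-{v})) = (\<Sum>v\<in>\<pi>-\<sigma>. \<Sum>w\<in>\<pi>-{v}-\<sigma>. e (\<pi>-{v}-{w}) F)"
        using F \<pi> by (intro sum.cong refl g Vex) (auto simp: cofaces_def)
      also have "\<dots> = 0"
      proof -
        have "card (\<pi> - \<sigma>) = 3" using \<pi> fs by (auto simp: cofaces_def card_Diff_subset)
        then obtain a b c where abc: "\<pi> - \<sigma> = {a,b,c}" "a \<noteq> b" "b \<noteq> c" "a \<noteq> c" by (auto simp: card_3_iff)
        define E where "E x y = e (\<pi>-{x}-{y}) F" for x y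
        have E: "E y x = E x y" for x y
        proof -
          have "\<pi>-{y}-{x} = \<pi>-{x}-{y}" by blast
          then show ?thesis by (simp only: E_def)
        qed
        have d: "\<pi>-{a}-\<sigma> = {b,c}" "\<pi>-{b}-\<sigma> = {a,c}" "\<pi>-{c}-\<sigma> = {a,b}" using abc by auto
        have "(\<Sum>v\<in>{a,b,c}. \<Sum>w\<in>\<pi>-{v}-\<sigma>. E v w)
            = (\<Sum>w\<in>\<pi>-{a}-\<sigma>. E a w) + ((\<Sum>w\<in>\<pi>-{b}-\<sigma>. E b w) + (\<Sum>w\<in>\<pi>-{c}-\<sigma>. E c w))"
          using abc(2,3,4) by simp
        also have "\<dots> = (E a b + E a c) + ((E a b + E b c) + (E a c + E b c))"
          unfolding d using abc(2,3,4) by (simp add: E[of b a] E[of c a] E[of c b])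
        also have "\<dots> = 0" by (cases "E a b"; cases "E a c"; cases "E b c") auto
        finally show ?thesis unfolding abc(1) E_def .
      qed
      finally show ?thesis .
    qed
    obtain F0 where F0: "F0 \<in> K" "\<sigma> \<subseteq> F0" "card F0 = Suc n" using facet_exists[OF \<sigma>] by (auto simp: cofaces_def)
    then have "\<sigma> \<noteq> F0" using 3 by auto
    then obtain v0 where v0: "v0 \<in> F0" "v0 \<notin> \<sigma>" using F0 by blast
    define \<tau>0 where "\<tau>0 = insert v0 \<sigma>"
    have \<tau>0: "\<tau>0 \<in> ?V" using v0 F0 face[of F0 \<tau>0] fs by (auto simp: cofaces_def \<tau>0_def)
    \<comment> \<open>Degree 0 acyclicity of the link provides a mod 2 path from the base vertex
      \<open>\<tau>0\<close> to \<open>\<tau>1\<close>. The function \<open>h\<close> below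
      integrates \<open>g\<close> along this path.\<close>
    have "\<exists>u. \<forall>\<tau>\<in>?V. bdry2 K u \<tau> = of_bool (\<tau> = \<tau>1) + of_bool (\<tau> = \<tau>0)" if \<tau>1: "\<tau>1 \<in> ?V" for \<tau>1
    proof (rule acyclic[OF \<sigma>])
      show "?k \<le> n" using 3 by simp
      fix \<tau> assume "\<tau> \<in> K" "\<sigma> \<subseteq> \<tau>" "Suc (card \<tau>) = ?k"
      then have "\<tau> = \<sigma>" using coface_card_eq by auto
      then show "bdry2 K (\<lambda>\<tau>. of_bool (\<tau> = \<tau>1) + of_bool (\<tau> = \<tau>0)) \<tau> = 0"
        unfolding bdry2_add using \<tau>0 \<tau>1 by (simp add: bdry2_single complex fin cofaces_def)
    qed
    then obtain c where c: "bdry2 K (c \<tau>1) \<tau> = of_bool (\<tau> = \<tau>1) + of_bool (\<tau> = \<tau>0)"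
      if "\<tau>1 \<in> ?V" "\<tau> \<in> ?V" for \<tau>1 \<tau> by metis
    let ?E = "cofaces K \<sigma> (Suc ?k)"
    define h where "h \<tau> = (\<Sum>\<rho>\<in>?E. g \<rho> * c \<tau> \<rho>)" for \<tau>
    have hg: "h \<tau> + h \<tau>' = g \<rho>"
      if \<tau>: "\<tau> \<in> ?V" "\<tau>' \<in> ?V" "\<tau> \<noteq> \<tau>'" and \<rho>: "\<rho> \<in> ?E" "\<tau> \<subseteq> \<rho>" "\<tau>' \<subseteq> \<rho>" for \<tau> \<tau>' \<rho>
    proof -
      \<comment> \<open>The two paths from \<open>\<tau>0\<close> and the edge \<open>\<rho>\<close>
        close up to a 1-cycle of the link, on which the cocycle \<open>g\<close> vanishes.\<close>
      have "(\<Sum>\<rho>'\<in>?E. g \<rho>' * (c \<tau> \<rho>' + c \<tau>' \<rho>' + of_bool (\<rho>' = \<rho>))) = 0"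
      proof (rule cocycle_annihilates_cycle[OF \<sigma>])
        show "Suc ?k \<le> n" using 3 by simp
        fix t assume t: "t \<in> K" "\<sigma> \<subseteq> t" "Suc (card t) = Suc ?k"
        then have tV: "t \<in> ?V" by (auto simp: cofaces_def)
        obtain a b where ab: "a \<noteq> b" "\<rho> - \<sigma> = {a,b}" using two[OF \<rho>(1)] by blast
        have "t \<subseteq> \<rho> \<longleftrightarrow> t = \<tau> \<or> t = \<tau>'"
        proof
          assume "t \<subseteq> \<rho>"
          show "t = \<tau> \<or> t = \<tau>'"
          proof (rule ccontr)
            assume n: "\<not> (t = \<tau> \<or> t = \<tau>')"
            have one: "\<exists>x\<in>{a,b}. s = insert x \<sigma>" if "s \<in> ?V" "s \<subseteq> \<rho>" for s
            proof -
              have "card (s - \<sigma>) = 1" using V[OF that(1)] fs by (simp add: card_Diff_subset)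
              then obtain x where x: "s - \<sigma> = {x}" by (meson card_1_singletonE)
              then show ?thesis using V(2)[OF that(1)] that(2) ab by (intro bexI[of _ x]) auto
            qed
            show False using one[OF tV \<open>t \<subseteq> \<rho>\<close>] one[OF \<tau>(1) \<rho>(2)] one[OF \<tau>(2) \<rho>(3)] n \<tau>(3) by auto
          qed
        qed (use \<rho> in auto)
        moreover have "\<rho> \<in> K" "card \<rho> = Suc ?k" using \<rho> by (auto simp: cofaces_def)
        ultimately have "bdry2 K (\<lambda>\<rho>'. of_bool (\<rho>' = \<rho>)) t = of_bool (t = \<tau>) + of_bool (t = \<tau>')"
          using \<tau>(3) t by (auto simp: bdry2_single complex fin)
        then show "bdry2 K (\<lambda>\<rho>'. c \<tau> \<rho>' + c \<tau>' \<rho>' + of_bool (\<rho>' = \<rho>)) t = 0"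
          unfolding bdry2_add c[OF \<tau>(1) tV] c[OF \<tau>(2) tV]
          by (cases "t = \<tau>"; cases "t = \<tau>'"; cases "t = \<tau>0") auto
      qed (rule gcoc)
      moreover have "(\<Sum>\<rho>'\<in>?E. g \<rho>' * of_bool (\<rho>' = \<rho>)) = g \<rho>"
        using \<rho>(1) by (subst sum.remove[of _ \<rho>]) (auto simp: finite_cofaces fin intro!: sum.neutral)
      ultimately have "h \<tau> + h \<tau>' + g \<rho> = 0"
        by (simp add: h_def distrib_left sum.distrib)
      then show ?thesis by (simp only: bit_add_eq_0_iff)
    qed
    have indep: "e \<tau> F + h \<tau> = e \<tau>' F + h \<tau>'"
      if \<tau>: "\<tau> \<in> ?V" "\<tau>' \<in> ?V" and F: "F \<in> K" "card F = Suc n" "\<tau> \<subseteq> F" "\<tau>' \<subseteq> F" for \<tau> \<tau>' F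
    proof (cases "\<tau> = \<tau>'")
      case False
      have "card (\<tau> - \<sigma>) = 1" "card (\<tau>' - \<sigma>) = 1" using V[OF \<tau>(1)] V[OF \<tau>(2)] fs by (simp_all add: card_Diff_subset)
      then obtain a b where "\<tau> - \<sigma> = {a}" "\<tau>' - \<sigma> = {b}" by (metis card_1_singletonE)
      then have ab: "\<tau> = insert a \<sigma>" "\<tau>' = insert b \<sigma>" "a \<notin> \<sigma>" "b \<notin> \<sigma>" "a \<noteq> b"
        using V(2) \<tau> False by auto
      let ?\<rho> = "insert a (insert b \<sigma>)"
      have \<rho>: "?\<rho> \<in> ?E" using ab F face[OF F(1), of ?\<rho>] fs by (auto simp: cofaces_def)
      moreover have "?\<rho> - \<sigma> = {a,b}" "?\<rho> - {a} = \<tau>'" "?\<rho> - {b} = \<tau>" using ab by auto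
      moreover have "F \<in> cofaces K ?\<rho> (Suc n)" using F ab by (auto simp: cofaces_def)
      ultimately have "g ?\<rho> = e \<tau>' F + e \<tau> F" using g[of ?\<rho> F] ab by simp
      moreover have "h \<tau> + h \<tau>' = g ?\<rho>" using hg[OF \<tau> False \<rho>] ab by auto
      ultimately have "h \<tau> + h \<tau>' = e \<tau>' F + e \<tau> F" by simp
      then show ?thesis
        by (cases "e \<tau> F"; cases "e \<tau>' F"; cases "h \<tau>"; cases "h \<tau>'") auto
    qed simp
    define \<epsilon> where "\<epsilon> F = (let \<tau> = SOME \<tau>. \<tau> \<in> ?V \<and> \<tau> \<subseteq> F in e \<tau> F + h \<tau>)" for F
    have \<epsilon>: "\<epsilon> F = e \<tau> F + h \<tau>" if "\<tau> \<in> ?V" "\<tau> \<subseteq> F" "F \<in> K" "card F = Suc n" for F \<tau>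
    proof -
      have "(SOME \<tau>. \<tau> \<in> ?V \<and> \<tau> \<subseteq> F) \<in> ?V \<and> (SOME \<tau>. \<tau> \<in> ?V \<and> \<tau> \<subseteq> F) \<subseteq> F"
        by (rule someI[of _ \<tau>]) (use that in auto)
      then show ?thesis unfolding \<epsilon>_def Let_def using that by (intro indep) auto
    qed
    have "coherent K n \<sigma> \<epsilon>" unfolding coherent_def
    proof (intro ballI impI)
      fix R v w assume R: "R \<in> cofaces K \<sigma> n" and vw: "v \<in> cofvs K R" "w \<in> cofvs K R" "v \<noteq> w"
      have R': "R \<in> K" "\<sigma> \<subseteq> R" "card R = n" "finite R" using R finite_simplex by (auto simp: cofaces_def)
      have "\<sigma> \<noteq> R" using 3 R'(3) by auto
      then obtain a where a: "a \<in> R" "a \<notin> \<sigma>" using R'(2) by blast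
      define \<tau> where "\<tau> = insert a \<sigma>"
      have \<tau>: "\<tau> \<in> ?V" "\<tau> \<subseteq> R" using a R' fs face[OF R'(1), of \<tau>] by (auto simp: \<tau>_def cofaces_def)
      have "\<epsilon> (insert x R) = e \<tau> (insert x R) + h \<tau>" if "x \<in> cofvs K R" for x
      proof (rule \<epsilon>[OF \<tau>(1)])
        have "x \<notin> R" "insert x R \<in> K" using that by (auto simp: cofvs_def)
        then show "\<tau> \<subseteq> insert x R" "insert x R \<in> K" "card (insert x R) = Suc n"
          using \<tau>(2) R'(3,4) by auto
      qed
      moreover have "e \<tau> (insert v R) + e \<tau> (insert w R) = 1 + vpos R v + vpos R w"
      proof -
        have "R \<in> cofaces K \<tau> n" using R'(1,3) \<tau>(2) by (simp add: cofaces_def)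
        then show ?thesis using e[OF \<tau>(1), unfolded coherent_def] vw by blast
      qed
      ultimately show "\<epsilon> (insert v R) + \<epsilon> (insert w R) = 1 + vpos R v + vpos R w"
        using vw by (cases "h \<tau>") (auto simp: add_ac)
    qed
    then show ?thesis by blast
  qed
qed

end


section \<open>Evaluating integer chains mod 2\<close>

text \<open>The pairing of a mod 2 cochain with an integral chain: singular chains stay integral and
  only the result is reduced.\<close>

definition mod2_eval :: "('a \<Rightarrow> bit) \<Rightarrow> ('a \<Rightarrow>\<^sub>0 int) \<Rightarrow> bit" where
  "mod2_eval f c = (\<Sum>s\<in>Poly_Mapping.keys c. of_int (Poly_Mapping.lookup c s) * f s)"

lemma mod2_eval_superset:
  assumes "finite S" "Poly_Mapping.keys c \<subseteq> S"
  shows "mod2_eval f c = (\<Sum>s\<in>S. of_int (Poly_Mapping.lookup c s) * f s)"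
  unfolding mod2_eval_def using assms by (intro sum.mono_neutral_left) (auto simp: in_keys_iff)

lemma mod2_eval_0 [simp]: "mod2_eval f 0 = 0"
  by (simp add: mod2_eval_def)

lemma mod2_eval_of [simp]: "mod2_eval f (frag_of s) = f s"
  by (simp add: mod2_eval_def)

lemma mod2_eval_add: "mod2_eval f (a + b) = mod2_eval f a + mod2_eval f b"
proof -
  let ?S = "Poly_Mapping.keys a \<union> Poly_Mapping.keys b"
  have "mod2_eval f (a + b) = (\<Sum>s\<in>?S. of_int (Poly_Mapping.lookup (a + b) s) * f s)"
    by (rule mod2_eval_superset) (auto simp: keys_add)
  moreover have "mod2_eval f a = (\<Sum>s\<in>?S. of_int (Poly_Mapping.lookup a s) * f s)"
      "mod2_eval f b = (\<Sum>s\<in>?S. of_int (Poly_Mapping.lookup b s) * f s)"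
    by (auto intro!: mod2_eval_superset)
  ultimately show ?thesis by (simp add: lookup_add distrib_right sum.distrib)
qed

lemma mod2_eval_cmul: "mod2_eval f (frag_cmul k c) = of_int k * mod2_eval f c"
proof -
  have "mod2_eval f (frag_cmul k c)
      = (\<Sum>s\<in>Poly_Mapping.keys c. of_int (Poly_Mapping.lookup (frag_cmul k c) s) * f s)"
    by (rule mod2_eval_superset) (auto simp: keys_cmul)
  then show ?thesis by (simp add: mod2_eval_def sum_distrib_left mult.assoc)
qed

lemma mod2_eval_sum: "mod2_eval f (sum g I) = (\<Sum>i\<in>I. mod2_eval f (g i))"
  by (induction I rule: infinite_finite_induct) (auto simp: mod2_eval_add)

lemma mod2_eval_extend: "mod2_eval f (frag_extend g c) = mod2_eval (\<lambda>s. mod2_eval f (g s)) c"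
  unfolding frag_extend_def by (simp add: mod2_eval_sum mod2_eval_cmul) (simp add: mod2_eval_def)

lemma mod2_eval_cong: "(\<And>s. s \<in> Poly_Mapping.keys c \<Longrightarrow> f s = g s) \<Longrightarrow> mod2_eval f c = mod2_eval g c"
  by (simp add: mod2_eval_def)

lemma mod2_eval_eq_0: "(\<And>s. s \<in> Poly_Mapping.keys c \<Longrightarrow> f s = 0) \<Longrightarrow> mod2_eval f c = 0"
  by (simp add: mod2_eval_def)

lemma mod2_eval_fun_sum: "mod2_eval (\<lambda>s. \<Sum>i\<in>I. f i s) c = (\<Sum>i\<in>I. mod2_eval (f i) c)"
  unfolding mod2_eval_def sum_distrib_left by (rule sum.swap)

lemma mod2_eval_lookup: "mod2_eval (\<lambda>s'. of_bool (s' = s)) c = of_int (Poly_Mapping.lookup c s)"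
proof -
  have "mod2_eval (\<lambda>s'. of_bool (s' = s)) c
      = (\<Sum>s'\<in>insert s (Poly_Mapping.keys c). of_int (Poly_Mapping.lookup c s') * of_bool (s' = s))"
    by (rule mod2_eval_superset) auto
  also have "\<dots> = of_int (Poly_Mapping.lookup c s)"
    by (subst sum.remove[of _ s]) auto
  finally show ?thesis .
qed

section \<open>Linear singular simplices\<close>

definition vindex :: "'v::linorder set \<Rightarrow> 'v \<Rightarrow> nat" where
  "vindex \<tau> v = card {w\<in>\<tau>. w < v}"

text \<open>The affine simplex whose corners are the vertices of \<open>\<tau>\<close> in increasing
  order, so that omitting the vertex of index k is the k-th face and the signs agree.
  \<open>restrict\<close> gives the extensionality demanded of singular simplices.\<close>

definition lin_simplex :: "nat \<Rightarrow> 'v::linorder set \<Rightarrow> (nat \<Rightarrow> real) \<Rightarrow> 'v \<Rightarrow> real" where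
  "lin_simplex p \<tau> = restrict (\<lambda>t v. if v \<in> \<tau> then t (vindex \<tau> v) else 0) (standard_simplex p)"

lemma vindex_less: "finite \<tau> \<Longrightarrow> u \<in> \<tau> \<Longrightarrow> u < v \<Longrightarrow> vindex \<tau> u < vindex \<tau> v"
  unfolding vindex_def by (rule psubset_card_mono) auto

lemma bij_betw_vindex:
  assumes "finite \<tau>" shows "bij_betw (vindex \<tau>) \<tau> {..<card \<tau>}"
proof -
  have inj: "inj_on (vindex \<tau>) \<tau>"
    by (rule linorder_inj_onI') (use assms vindex_less in fastforce)
  have "vindex \<tau> ` \<tau> \<subseteq> {..<card \<tau>}"
    unfolding vindex_def using assms by (auto intro!: psubset_card_mono)
  moreover have "card (vindex \<tau> ` \<tau>) = card {..<card \<tau>}" using inj by (simp add: card_image)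
  ultimately have "vindex \<tau> ` \<tau> = {..<card \<tau>}" by (intro card_subset_eq) auto
  then show ?thesis using inj by (simp add: bij_betw_def)
qed

lemma vindex_remove:
  assumes "finite \<tau>" "u \<in> \<tau>" "v \<in> \<tau>"
  shows "vindex (\<tau>-{u}) v = (if u < v then vindex \<tau> v - 1 else vindex \<tau> v)"
proof -
  have "{w\<in>\<tau>-{u}. w < v} = (if u < v then {w\<in>\<tau>. w < v} - {u} else {w\<in>\<tau>. w < v})" by auto
  then show ?thesis using assms by (simp add: vindex_def)
qed

lemma sum_vindex:
  assumes "finite \<tau>" "card \<tau> = Suc p" shows "(\<Sum>v\<in>\<tau>. g (vindex \<tau> v)) = (\<Sum>i\<le>p. g i)"
  using sum.reindex_bij_betw[OF bij_betw_vindex[OF assms(1)], of g] assms(2) by (simp add: lessThan_Suc_atMost)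

lemma topspace_realtop [simp]: "topspace (realtop K) = realization K"
  by (simp add: realtop_def)

lemma realizationD:
  assumes "y \<in> realization K"
  shows "0 \<le> y v" "{v. y v \<noteq> 0} \<in> K" "(\<Sum>v\<in>{v. y v \<noteq> 0}. y v) = 1"
  using assms by (auto simp: realization_def)

lemma sum_realization:
  assumes "y \<in> realization K" "finite S" "{v. y v \<noteq> 0} \<subseteq> S" shows "(\<Sum>v\<in>S. y v) = 1"
proof -
  have "(\<Sum>v\<in>{v. y v \<noteq> 0}. y v) = (\<Sum>v\<in>S. y v)"
    by (rule sum.mono_neutral_left[OF assms(2,3)]) auto
  then show ?thesis using realizationD(3)[OF assms(1)] by simp
qed

lemma realizationI:
  assumes "\<And>v. 0 \<le> y v" "simplicial_complex K" "\<tau> \<in> K" "{v. y v \<noteq> 0} \<subseteq> \<tau>" "(\<Sum>v\<in>\<tau>. y v) = 1"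
  shows "y \<in> realization K"
proof -
  have "finite \<tau>" using assms simplicial_complex_finite by blast
  then have "(\<Sum>v\<in>{v. y v \<noteq> 0}. y v) = (\<Sum>v\<in>\<tau>. y v)"
    by (rule sum.mono_neutral_left[OF _ assms(4)]) auto
  then have "(\<Sum>v\<in>{v. y v \<noteq> 0}. y v) = 1" using assms(5) by simp
  then show ?thesis using assms simplicial_complex_subset by (auto simp: realization_def)
qed

lemma lin_simplex_support:
  assumes "t \<in> standard_simplex p" shows "{v. lin_simplex p \<tau> t v \<noteq> 0} \<subseteq> \<tau>"
  using assms by (auto simp: lin_simplex_def)

lemma lin_simplex_in_realization:
  assumes "simplicial_complex K" "\<tau> \<in> K" "card \<tau> = Suc p" "t \<in> standard_simplex p"
  shows "lin_simplex p \<tau> t \<in> realization K"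
proof (rule realizationI[OF _ assms(1,2) lin_simplex_support[OF assms(4)]])
  show "0 \<le> lin_simplex p \<tau> t v" for v using assms(4) by (auto simp: lin_simplex_def standard_simplex_def)
  have "(\<Sum>v\<in>\<tau>. lin_simplex p \<tau> t v) = (\<Sum>v\<in>\<tau>. t (vindex \<tau> v))"
    using assms(4) by (auto simp: lin_simplex_def)
  also have "\<dots> = (\<Sum>i\<le>p. t i)" using assms simplicial_complex_finite by (intro sum_vindex) auto
  finally show "(\<Sum>v\<in>\<tau>. lin_simplex p \<tau> t v) = 1" using assms(4) by (simp add: standard_simplex_def)
qed

lemma singular_simplex_lin_simplex:
  assumes "simplicial_complex K" "\<tau> \<in> K" "card \<tau> = Suc p"
  shows "singular_simplex p (realtop K) (lin_simplex p \<tau>)"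
proof -
  let ?S = "subtopology (powertop_real UNIV) (standard_simplex p)"
  have "continuous_map ?S euclideanreal (\<lambda>t. lin_simplex p \<tau> t v)" for v
  proof -
    have "continuous_map ?S euclideanreal (\<lambda>t. if v \<in> \<tau> then t (vindex \<tau> v) else 0)"
      by (cases "v \<in> \<tau>") (auto intro!: continuous_map_from_subtopology continuous_map_product_projection)
    then show ?thesis by (rule continuous_map_eq) (auto simp: lin_simplex_def)
  qed
  then have "continuous_map ?S (powertop_real UNIV) (lin_simplex p \<tau>)"
    by (simp add: continuous_map_componentwise_UNIV)
  then show ?thesis
    unfolding singular_simplex_def realtop_def continuous_map_in_subtopology
    using lin_simplex_in_realization[OF assms] by (auto simp: lin_simplex_def)
qed

lemma lin_simplex_inject:
  assumes "finite \<tau>" "finite \<tau>'" "card \<tau> = Suc p" "card \<tau>' = Suc p"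
  shows "lin_simplex p \<tau> = lin_simplex p \<tau>' \<longleftrightarrow> \<tau> = \<tau>'"
proof
  \<comment> \<open>At the centre of the standard simplex no barycentric coordinate vanishes, so the
    support of the image recovers the vertex set.\<close>
  define t :: "nat \<Rightarrow> real" where "t i = (if i \<le> p then 1 / Suc p else 0)" for i
  have t: "t \<in> standard_simplex p" by (auto simp: standard_simplex_def t_def)
  have *: "{v. lin_simplex p \<rho> t v \<noteq> 0} = \<rho>" if "finite \<rho>" "card \<rho> = Suc p" for \<rho> :: "'a set"
  proof -
    have "vindex \<rho> v \<le> p" if "v \<in> \<rho>" for v
      using bij_betw_apply[OF bij_betw_vindex[OF \<open>finite \<rho>\<close>] that] \<open>card \<rho> = Suc p\<close> by simp
    then show ?thesis using t by (auto simp: lin_simplex_def t_def)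
  qed
  assume eq: "lin_simplex p \<tau> = lin_simplex p \<tau>'"
  show "\<tau> = \<tau>'"
    using *[OF assms(1,3)] *[OF assms(2,4)] unfolding eq by (rule trans[OF sym])
qed simp

lemma singular_face_lin_simplex:
  assumes "finite \<tau>" "card \<tau> = Suc (Suc p)" "u \<in> \<tau>"
  shows "singular_face (Suc p) (vindex \<tau> u) (lin_simplex (Suc p) \<tau>) = lin_simplex p (\<tau>-{u})"
proof (rule ext, rule ext)
  fix t v
  show "singular_face (Suc p) (vindex \<tau> u) (lin_simplex (Suc p) \<tau>) t v = lin_simplex p (\<tau>-{u}) t v"
  proof (cases "t \<in> standard_simplex p")
    case True
    have "vindex \<tau> u < card \<tau>" using bij_betw_apply[OF bij_betw_vindex] assms by blast
    then have sf: "simplical_face (vindex \<tau> u) t \<in> standard_simplex (Suc p)"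
      using simplical_face_in_standard_simplex[of "Suc p" "vindex \<tau> u" t] True assms by simp
    have "singular_face (Suc p) (vindex \<tau> u) (lin_simplex (Suc p) \<tau>) t v
        = (if v \<in> \<tau> then simplical_face (vindex \<tau> u) t (vindex \<tau> v) else 0)"
      using True sf by (simp add: singular_face_def lin_simplex_def)
    also have "\<dots> = (if v \<in> \<tau>-{u} then t (vindex (\<tau>-{u}) v) else 0)"
    proof (cases "v \<in> \<tau>")
      case True
      consider "v < u" | "v = u" | "u < v" by fastforce
      then show ?thesis
        using True assms vindex_less[of \<tau> v u] vindex_less[of \<tau> u v] vindex_remove[of \<tau> u v]
        by cases (auto simp: simplical_face_def)
    qed auto
    finally show ?thesis using True by (simp add: lin_simplex_def)
  qed (simp add: singular_face_def lin_simplex_def)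
qed

lemma chain_boundary_lin_simplex:
  assumes "finite \<tau>" "card \<tau> = Suc (Suc p)"
  shows "chain_boundary (Suc p) (frag_of (lin_simplex (Suc p) \<tau>))
       = (\<Sum>u\<in>\<tau>. frag_cmul ((-1) ^ vindex \<tau> u) (frag_of (lin_simplex p (\<tau>-{u}))))"
proof -
  let ?g = "\<lambda>k. frag_cmul ((-1) ^ k) (frag_of (singular_face (Suc p) k (lin_simplex (Suc p) \<tau>)))"
  have "chain_boundary (Suc p) (frag_of (lin_simplex (Suc p) \<tau>)) = (\<Sum>k\<le>Suc p. ?g k)"
    by (simp add: chain_boundary_of)
  also have "\<dots> = (\<Sum>u\<in>\<tau>. ?g (vindex \<tau> u))" using sum_vindex[OF assms, of ?g] by simp
  also have "\<dots> = (\<Sum>u\<in>\<tau>. frag_cmul ((-1) ^ vindex \<tau> u) (frag_of (lin_simplex p (\<tau>-{u}))))"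
    using assms by (intro sum.cong) (auto simp: singular_face_lin_simplex)
  finally show ?thesis .
qed

section \<open>Iterated subdivision\<close>

abbreviation Sd :: "nat \<Rightarrow> nat \<Rightarrow> 'a chain \<Rightarrow> 'a chain" where
  "Sd p m \<equiv> singular_subdivision p ^^ m"

lemma Sd_add: "Sd p m (a + b) = Sd p m a + Sd p m b"
  by (induction m) (auto simp: singular_subdivision_add)

lemma Sd_cmul: "Sd p m (frag_cmul k c) = frag_cmul k (Sd p m c)"
  by (induction m) (auto simp: singular_subdivision_def frag_extend_cmul)

lemma Sd_sum: "Sd p m (sum g I) = (\<Sum>i\<in>I. Sd p m (g i))"
  by (induction I rule: infinite_finite_induct) (auto simp: Sd_add)

lemma singular_chain_Sd: "singular_chain p X c \<Longrightarrow> singular_chain p X (Sd p m c)"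
  by (induction m) (auto simp: singular_chain_singular_subdivision)

lemma chain_boundary_Sd:
  "singular_chain (Suc p) X c \<Longrightarrow> chain_boundary (Suc p) (Sd (Suc p) m c) = Sd p m (chain_boundary (Suc p) c)"
  by (induction m) (simp_all add: chain_boundary_singular_subdivision[OF singular_chain_Sd])

lemma Sd_0_dim: "singular_chain 0 X c \<Longrightarrow> Sd 0 m c = c"
  by (induction m) (auto simp: singular_subdivision_zero)

section \<open>Labelling the vertices of singular simplices\<close>

text \<open>Only the set of labels is kept: mod 2 their order is irrelevant, and a degenerate
  labelling is recognised by having fewer than \<open>Suc p\<close> elements.\<close>

definition labels :: "('b \<Rightarrow> 'v) \<Rightarrow> nat \<Rightarrow> ((nat \<Rightarrow> real) \<Rightarrow> 'b) \<Rightarrow> 'v set" where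
  "labels \<phi> p s = (\<lambda>j. \<phi> (s (\<lambda>i. if i = j then 1 else 0))) ` {..p}"

abbreviation has_labels :: "('b \<Rightarrow> 'v) \<Rightarrow> nat \<Rightarrow> 'v set \<Rightarrow> ((nat \<Rightarrow> real) \<Rightarrow> 'b) \<Rightarrow> bit" where
  "has_labels \<phi> p \<tau> s \<equiv> of_bool (labels \<phi> p s = \<tau>)"

lemma labels_face:
  assumes "k \<le> Suc p"
  shows "labels \<phi> p (singular_face (Suc p) k s)
       = (\<lambda>j. \<phi> (s (\<lambda>i. if i = j then 1 else 0))) ` ({..Suc p} - {k})"
proof -
  let ?e = "\<lambda>j i::nat. if i = j then 1::real else 0"
  let ?d = "\<lambda>j. if j < k then j else Suc j"
  have "simplical_face k (?e j) = ?e (?d j)" for j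
    by (rule ext) (auto simp: simplical_face_def)
  then have "labels \<phi> p (singular_face (Suc p) k s) = (\<lambda>j. \<phi> (s (?e (?d j)))) ` {..p}"
    unfolding labels_def by (intro image_cong) (auto simp: singular_face_def)
  also have "\<dots> = (\<lambda>j. \<phi> (s (?e j))) ` ?d ` {..p}" by (simp only: image_image)
  also have "?d ` {..p} = {..Suc p} - {k}"
  proof -
    have "i \<in> ?d ` {..p}" if "i \<in> {..Suc p} - {k}" for i
      by (rule image_eqI[of _ _ "if i < k then i else i - 1"]) (use that assms in auto)
    then show ?thesis using assms by auto
  qed
  finally show ?thesis .
qed

text \<open>
  The labelling is a chain map mod 2 although degenerate label sets are sent to zero: a simplex
  with exactly one repeated label has two faces with equal label sets.
\<close>

lemma degenerate_faces_cancel: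
  fixes w :: "nat \<Rightarrow> 'v"
  assumes "finite \<tau>" "card \<tau> = Suc p"
  shows "(\<Sum>k\<le>Suc p. of_bool (w ` ({..Suc p} - {k}) = \<tau>) :: bit)
       = of_bool (\<exists>v. v \<notin> \<tau> \<and> w ` {..Suc p} = insert v \<tau>)"
proof -
  let ?I = "{..Suc p}" and ?W = "w ` {..Suc p}"
  let ?k = "{k\<in>?I. w ` (?I - {k}) = \<tau>}"
  have sum: "(\<Sum>k\<le>Suc p. of_bool (w ` (?I - {k}) = \<tau>) :: bit) = of_nat (card ?k)"
    by (simp add: sum.inter_filter[symmetric] of_bool_def del: sum.atMost_Suc)
  have W: "?W = insert (w k) (w ` (?I - {k}))" if "k \<in> ?I" for k using that by auto
  show ?thesis
  proof (cases "inj_on w ?I")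
    case True
    have eq: "w ` (?I - {k}) = ?W - {w k}" if "k \<in> ?I" for k
      using inj_on_image_set_diff[OF True, of ?I "{k}"] that by auto
    show ?thesis
    proof (cases "\<exists>v. v \<notin> \<tau> \<and> ?W = insert v \<tau>")
      case T: True
      then obtain v where v: "v \<notin> \<tau>" "?W = insert v \<tau>" by blast
      then have "v \<in> ?W" by simp
      then obtain k0 where k0: "k0 \<in> ?I" "w k0 = v" by (elim imageE) simp
      have "w ` (?I - {k}) = \<tau> \<longleftrightarrow> k = k0" if "k \<in> ?I" for k
      proof
        assume "w ` (?I - {k}) = \<tau>"
        then have "insert v \<tau> - {w k} = \<tau>" using eq[OF that] v(2) by simp
        then have "v \<notin> insert v \<tau> - {w k}" using v(1) by (simp only: not_False_eq_True)
        then have "w k = w k0" using k0(2) by simp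
        then show "k = k0" by (rule inj_onD[OF True _ that k0(1)])
      next
        assume "k = k0"
        then show "w ` (?I - {k}) = \<tau>" using eq[OF that] v k0(2) by simp
      qed
      then have "?k = {k0}" using k0(1) by blast
      then show ?thesis using T sum by simp
    next
      case F: False
      have "?k = {}"
      proof (rule ccontr)
        assume "?k \<noteq> {}"
        then obtain k where k: "k \<in> ?I" "w ` (?I - {k}) = \<tau>" by blast
        have "w k \<notin> \<tau>" unfolding k(2)[symmetric] eq[OF k(1)] by simp
        moreover have "?W = insert (w k) \<tau>" unfolding k(2)[symmetric] by (rule W[OF k(1)])
        ultimately show False using F by blast
      qed
      then show ?thesis using F sum by simp
    qed
  next
    case False
    then obtain k1 k2 where k12: "k1 \<in> ?I" "k2 \<in> ?I" "k1 \<noteq> k2" "w k1 = w k2" by (auto simp: inj_on_def)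
    \<comment> \<open>Omitting one of two equal labels loses nothing, so both omissions leave all of
      \<open>?W\<close>. It thus has at most \<open>Suc p\<close> elements and cannot be
      \<open>insert v \<tau>\<close> with \<open>v\<close> new.\<close>
    have "w k1 \<in> w ` (?I - {k1})" "w k2 \<in> w ` (?I - {k2})"
      using imageI[of k2 "?I - {k1}" w] imageI[of k1 "?I - {k2}" w] k12 by auto
    then have W1: "w ` (?I - {k1}) = ?W" "w ` (?I - {k2}) = ?W"
      using insert_absorb W[OF k12(1)] W[OF k12(2)] by metis+
    have cW: "card ?W \<le> Suc p"
      using W1(1) card_image_le[of "?I - {k1}" w] k12(1) by simp
    have nex: "\<not> (\<exists>v. v \<notin> \<tau> \<and> ?W = insert v \<tau>)" using cW assms by auto
    show ?thesis
    proof (cases "?W = \<tau>")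
      case True
      have "card (?I - {k1}) = Suc p" using k12(1) by simp
      then have inj: "inj_on w (?I - {k1})" using W1(1) True assms by (intro eq_card_imp_inj_on) simp_all
      \<comment> \<open>Off \<open>k1\<close> the labelling is injective, so any label other than
        the repeated one occurs once and its omission shrinks the set. Exactly the terms for
        \<open>k1\<close> and \<open>k2\<close> survive and cancel.\<close>
      have "w ` (?I - {k}) \<noteq> \<tau>" if k: "k \<in> ?I" "k \<noteq> k1" "k \<noteq> k2" for k
      proof
        assume "w ` (?I - {k}) = \<tau>"
        then have "w k \<in> w ` (?I - {k})" using True k(1) by blast
        then obtain j where j: "j \<in> ?I" "j \<noteq> k" "w k = w j" by blast
        define j' where "j' = (if j = k1 then k2 else j)"
        have "j' \<in> ?I - {k1}" "w k = w j'" "j' \<noteq> k" using j k12 k by (auto simp: j'_def)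
        then show False using inj_onD[OF inj, of k j'] k by blast
      qed
      moreover have "w ` (?I - {k}) = \<tau>" if "k = k1 \<or> k = k2" for k
        using that W1 True by (elim disjE) simp_all
      ultimately have iff: "w ` (?I - {k}) = \<tau> \<longleftrightarrow> k = k1 \<or> k = k2" if "k \<in> ?I" for k
        using that by metis
      have "?k = {k\<in>?I. k = k1 \<or> k = k2}" by (intro Collect_cong conj_cong refl iff)
      also have "\<dots> = {k1,k2}" using k12(1,2) by blast
      finally have "?k = {k1,k2}" .
      then show ?thesis using sum k12(3) nex by simp
    next
      case F: False
      have "?k = {}"
      proof (rule ccontr)
        assume "?k \<noteq> {}"
        then obtain k where "w ` (?I - {k}) = \<tau>" by blast
        moreover have "w ` (?I - {k}) \<subseteq> ?W" by (intro image_mono) blast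
        ultimately have "\<tau> \<subseteq> ?W" by simp
        then have "\<tau> = ?W" using cW assms by (intro card_seteq) auto
        then show False using F by simp
      qed
      then show ?thesis using sum nex by simp
    qed
  qed
qed

text \<open>The chain map property read on coefficients. \<open>bdry2\<close> sums only over
  simplices of \<open>K\<close>, hence the demand that every label set be one.\<close>

lemma mod2_eval_labels_boundary:
  assumes "simplicial_complex K" "finite K" "finite \<tau>" "card \<tau> = Suc p"
    and "\<And>s. s \<in> Poly_Mapping.keys c \<Longrightarrow> labels \<phi> (Suc p) s \<in> K"
  shows "mod2_eval (has_labels \<phi> p \<tau>) (chain_boundary (Suc p) c)
       = bdry2 K (\<lambda>\<rho>. mod2_eval (has_labels \<phi> (Suc p) \<rho>) c) \<tau>"
proof -
  have "mod2_eval (has_labels \<phi> p \<tau>) (chain_boundary (Suc p) c)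
      = mod2_eval (\<lambda>s. \<Sum>k\<le>Suc p. has_labels \<phi> p \<tau> (singular_face (Suc p) k s)) c"
    by (simp add: chain_boundary_def mod2_eval_extend mod2_eval_sum mod2_eval_add mod2_eval_cmul bit_of_int
        del: sum.atMost_Suc)
  also have "\<dots> = mod2_eval (\<lambda>s. \<Sum>v\<in>cofvs K \<tau>. has_labels \<phi> (Suc p) (insert v \<tau>) s) c"
  proof (rule mod2_eval_cong)
    fix s assume s: "s \<in> Poly_Mapping.keys c"
    let ?w = "\<lambda>j. \<phi> (s (\<lambda>i. if i = j then 1 else 0))"
    have "(\<Sum>k\<le>Suc p. has_labels \<phi> p \<tau> (singular_face (Suc p) k s))
        = (\<Sum>k\<le>Suc p. of_bool (?w ` ({..Suc p} - {k}) = \<tau>))"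
      by (intro sum.cong) (auto simp: labels_face)
    also have "\<dots> = of_bool (\<exists>v. v \<notin> \<tau> \<and> labels \<phi> (Suc p) s = insert v \<tau>)"
      unfolding labels_def by (rule degenerate_faces_cancel[OF assms(3,4)])
    also have "\<dots> = (\<Sum>v\<in>cofvs K \<tau>. has_labels \<phi> (Suc p) (insert v \<tau>) s)"
    proof (cases "\<exists>v. v \<notin> \<tau> \<and> labels \<phi> (Suc p) s = insert v \<tau>")
      case True
      then obtain v where v: "v \<notin> \<tau>" "labels \<phi> (Suc p) s = insert v \<tau>" by blast
      then have "v \<in> cofvs K \<tau>" using assms(5)[OF s] by (auto simp: cofvs_def)
      moreover have "(\<Sum>v'\<in>cofvs K \<tau> - {v}. has_labels \<phi> (Suc p) (insert v' \<tau>) s) = 0"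
        using v by (intro sum.neutral) (auto simp: cofvs_def)
      ultimately show ?thesis using True v by (subst sum.remove[of _ v]) (auto simp: finite_cofvs assms)
    next
      case False
      then have "(\<Sum>v\<in>cofvs K \<tau>. has_labels \<phi> (Suc p) (insert v \<tau>) s) = 0"
        by (intro sum.neutral) (auto simp: cofvs_def)
      then show ?thesis using False by simp
    qed
    finally show "(\<Sum>k\<le>Suc p. has_labels \<phi> p \<tau> (singular_face (Suc p) k s))
      = (\<Sum>v\<in>cofvs K \<tau>. has_labels \<phi> (Suc p) (insert v \<tau>) s)" .
  qed
  also have "\<dots> = bdry2 K (\<lambda>\<rho>. mod2_eval (has_labels \<phi> (Suc p) \<rho>) c) \<tau>"
    by (simp add: bdry2_def mod2_eval_fun_sum)
  finally show ?thesis .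
qed

text \<open>
  No chain homotopy is needed: supports force the image of a subdivided simplex to be a multiple of that
  simplex, and the multiplicity passes to faces, down to the vertices.
\<close>

lemma sperner:
  assumes K: "simplicial_complex K" "finite K"
    and \<phi>: "\<And>y. y \<in> realization K \<Longrightarrow> y (\<phi> y) \<noteq> 0"
    and \<tau>: "\<tau> \<in> K" "card \<tau> = Suc p" and \<tau>': "card \<tau>' = Suc p"
  shows "mod2_eval (has_labels \<phi> p \<tau>') (Sd p m (frag_of (lin_simplex p \<tau>))) = of_bool (\<tau>' = \<tau>)"
  using \<tau> \<tau>'
proof (induction p arbitrary: \<tau> \<tau>')
  \<comment> \<open>Subdivision never leaves the closed face spanned by \<open>\<tau>\<close>, and
    \<open>\<phi>\<close> picks a vertex in the support of a point.\<close>
  have sub: "labels \<phi> p s \<subseteq> \<tau>"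
    if \<tau>: "\<tau> \<in> K" "card \<tau> = Suc p" and s: "s \<in> Poly_Mapping.keys (Sd p m (frag_of (lin_simplex p \<tau>)))" for p \<tau> s
  proof -
    have "singular_chain p (subtopology (realtop K) {y. {v. y v \<noteq> 0} \<subseteq> \<tau>}) (frag_of (lin_simplex p \<tau>))"
      unfolding singular_chain_of singular_simplex_subtopology
      using singular_simplex_lin_simplex[OF K(1) \<tau>] lin_simplex_support by blast
    from singular_chain_Sd[OF this, of m] s
    have "singular_simplex p (subtopology (realtop K) {y. {v. y v \<noteq> 0} \<subseteq> \<tau>}) s"
      by (auto simp: singular_chain_def)
    then have "singular_simplex p (realtop K) s" "s ` standard_simplex p \<subseteq> {y. {v. y v \<noteq> 0} \<subseteq> \<tau>}"
      by (simp_all only: singular_simplex_subtopology)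
    moreover from this(1) have "s ` standard_simplex p \<subseteq> realization K"
      by (auto simp: singular_simplex_def continuous_map_def)
    ultimately have "s t \<in> realization K" "{v. s t v \<noteq> 0} \<subseteq> \<tau>" if "t \<in> standard_simplex p" for t
      using that by blast+
    then have "\<phi> (s t) \<in> \<tau>" if "t \<in> standard_simplex p" for t using \<phi> that by blast
    then show ?thesis by (auto simp: labels_def)
  qed
  have other: "mod2_eval (has_labels \<phi> p \<tau>') (Sd p m (frag_of (lin_simplex p \<tau>))) = 0"
    if \<tau>: "\<tau> \<in> K" "card \<tau> = Suc p" "card \<tau>' = Suc p" "\<tau>' \<noteq> \<tau>" for p \<tau> \<tau>'
  proof (rule mod2_eval_eq_0)
    fix s assume "s \<in> Poly_Mapping.keys (Sd p m (frag_of (lin_simplex p \<tau>)))"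
    then have "labels \<phi> p s \<subseteq> \<tau>" using sub \<tau> by blast
    then have "labels \<phi> p s \<noteq> \<tau>'"
      using \<tau> K simplicial_complex_finite card_subset_eq by metis
    then show "has_labels \<phi> p \<tau>' s = 0" by simp
  qed
  {
    case 0
    show ?case
    proof (cases "\<tau>' = \<tau>")
      case True
      have "\<exists>v. \<tau> = {v}" using 0 by (metis One_nat_def card_1_singletonE)
      moreover have "Sd 0 m (frag_of (lin_simplex 0 \<tau>)) = frag_of (lin_simplex 0 \<tau>)"
        using singular_simplex_lin_simplex[OF K(1) 0(1,2)] by (intro Sd_0_dim[of "realtop K"]) (simp add: singular_chain_of)
      moreover have "labels \<phi> 0 (lin_simplex 0 \<tau>) \<noteq> {}" by (simp add: labels_def)
      ultimately show ?thesis using sub[OF 0(1,2), of "lin_simplex 0 \<tau>"] True by auto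
    qed (use other 0 in auto)
  next
    case (Suc p)
    show ?case
    proof (cases "\<tau>' = \<tau>")
      case True
      let ?c = "frag_of (lin_simplex (Suc p) \<tau>)"
      have f: "finite \<tau>" using Suc.prems K simplicial_complex_finite by blast
      obtain u where u: "u \<in> \<tau>" using Suc.prems by fastforce
      have sc: "singular_chain (Suc p) (realtop K) ?c"
        using singular_simplex_lin_simplex[OF K(1) Suc.prems(1,2)] by (simp add: singular_chain_of)
      have cu: "card (\<tau> - {u}) = Suc p" using u f Suc.prems by simp
      \<comment> \<open>The boundary coefficient at the face opposite \<open>u\<close> is computed
        twice: the induction hypothesis on the subdivided faces gives 1, while by supports
        \<open>\<tau>\<close> is the only coface that can contribute. So \<open>\<tau>\<close>
        itself has multiplicity 1.\<close>
      have "bdry2 K (\<lambda>\<rho>. mod2_eval (has_labels \<phi> (Suc p) \<rho>) (Sd (Suc p) m ?c)) (\<tau>-{u})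
          = mod2_eval (has_labels \<phi> p (\<tau>-{u})) (chain_boundary (Suc p) (Sd (Suc p) m ?c))"
        using K f cu simplicial_complex_subset[OF K(1) Suc.prems(1) sub[OF Suc.prems(1,2)]]
        by (intro mod2_eval_labels_boundary[symmetric]) auto
      also have "\<dots> = mod2_eval (has_labels \<phi> p (\<tau>-{u})) (Sd p m (chain_boundary (Suc p) ?c))"
        by (simp only: chain_boundary_Sd[OF sc])
      also have "\<dots> = (\<Sum>v\<in>\<tau>. mod2_eval (has_labels \<phi> p (\<tau>-{u})) (Sd p m (frag_of (lin_simplex p (\<tau>-{v})))))"
        using f Suc.prems
        by (simp add: chain_boundary_lin_simplex Sd_sum Sd_cmul mod2_eval_sum mod2_eval_cmul bit_of_int)
      also have "\<dots> = (\<Sum>v\<in>\<tau>. of_bool (v = u))"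
      proof (rule sum.cong[OF refl])
        fix v assume v: "v \<in> \<tau>"
        have "mod2_eval (has_labels \<phi> p (\<tau>-{u})) (Sd p m (frag_of (lin_simplex p (\<tau>-{v}))))
            = of_bool (\<tau>-{u} = \<tau>-{v})"
          using Suc.prems simplicial_complex_subset[OF K(1)] f v cu by (intro Suc.IH) auto
        then show "mod2_eval (has_labels \<phi> p (\<tau>-{u})) (Sd p m (frag_of (lin_simplex p (\<tau>-{v})))) = of_bool (v = u)"
          using u v by auto
      qed
      also have "\<dots> = 1" using u f by (subst sum.remove[of _ u]) auto
      finally have 1: "bdry2 K (\<lambda>\<rho>. mod2_eval (has_labels \<phi> (Suc p) \<rho>) (Sd (Suc p) m ?c)) (\<tau>-{u}) = 1" .
      have "bdry2 K (\<lambda>\<rho>. mod2_eval (has_labels \<phi> (Suc p) \<rho>) (Sd (Suc p) m ?c)) (\<tau>-{u})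
          = (\<Sum>v\<in>cofvs K (\<tau>-{u}). if v = u then mod2_eval (has_labels \<phi> (Suc p) \<tau>) (Sd (Suc p) m ?c) else 0)"
        unfolding bdry2_def
      proof (rule sum.cong[OF refl])
        fix v assume v: "v \<in> cofvs K (\<tau>-{u})"
        show "mod2_eval (has_labels \<phi> (Suc p) (insert v (\<tau>-{u}))) (Sd (Suc p) m ?c)
          = (if v = u then mod2_eval (has_labels \<phi> (Suc p) \<tau>) (Sd (Suc p) m ?c) else 0)"
        proof (cases "v = u")
          case False
          then have "v \<notin> \<tau>" using v by (auto simp: cofvs_def)
          then show ?thesis using False cu f Suc.prems by (simp, intro other) auto
        qed (use u in \<open>simp add: insert_absorb\<close>)
      qed
      also have "\<dots> = mod2_eval (has_labels \<phi> (Suc p) \<tau>) (Sd (Suc p) m ?c)"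
        using u Suc.prems by (simp add: finite_cofvs K) (auto simp: cofvs_def insert_absorb)
      finally show ?thesis using 1 True by simp
    qed (use other Suc in auto)
  }
qed


section \<open>Comparison of simplicial and singular local cycles\<close>

definition barycenter :: "'v set \<Rightarrow> 'v \<Rightarrow> real" where
  "barycenter \<sigma> v = (if v \<in> \<sigma> then 1 / card \<sigma> else 0)"

lemma barycenter_support: "finite \<sigma> \<Longrightarrow> {v. barycenter \<sigma> v \<noteq> 0} = \<sigma>"
  by (auto simp: barycenter_def)

lemma sum_barycenter:
  assumes "finite S" "\<sigma> \<subseteq> S" "\<sigma> \<noteq> {}" shows "(\<Sum>v\<in>S. barycenter \<sigma> v) = 1"
proof -
  have f: "finite \<sigma>" using assms finite_subset by blast
  have "(\<Sum>v\<in>\<sigma>. barycenter \<sigma> v) = (\<Sum>v\<in>S. barycenter \<sigma> v)"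
    by (rule sum.mono_neutral_left) (use assms in \<open>auto simp: barycenter_def\<close>)
  moreover have "(\<Sum>v\<in>\<sigma>. barycenter \<sigma> v) = 1" using f assms by (simp add: barycenter_def)
  ultimately show ?thesis by simp
qed

lemma barycenter_in_realization:
  assumes "simplicial_complex K" "\<sigma> \<in> K" "\<sigma> \<noteq> {}" shows "barycenter \<sigma> \<in> realization K"
proof (rule realizationI[OF _ assms(1,2)])
  have "finite \<sigma>" using assms simplicial_complex_finite by blast
  then show "sum (barycenter \<sigma>) \<sigma> = 1" using assms by (intro sum_barycenter) auto
qed (auto simp: barycenter_def)

text \<open>For points of the realization and \<open>V = \<Union>K\<close> this is half the l1
  distance, because the coordinates have equal sums. In this form a lower bound forces a single
  difference \<open>y v - x v\<close> to be large.\<close>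

definition excess :: "'v set \<Rightarrow> ('v \<Rightarrow> real) \<Rightarrow> ('v \<Rightarrow> real) \<Rightarrow> real" where
  "excess V x y = (\<Sum>v\<in>V. max 0 (y v - x v))"

lemma continuous_map_realtop_coord: "continuous_map (realtop K) euclideanreal (\<lambda>y. y v)"
  unfolding realtop_def by (intro continuous_map_from_subtopology continuous_map_product_projection) simp

lemma continuous_map_excess:
  assumes "finite V" shows "continuous_map (realtop K) euclideanreal (excess V x)"
  unfolding excess_def
  by (intro continuous_map_sum continuous_map_real_max continuous_map_diff continuous_map_realtop_coord assms)
     simp_all


text \<open>Without positive excess \<open>y\<close> lies below \<open>x\<close> in every
  coordinate, and equal coordinate sums then force equality.\<close>

lemma excess_pos:
  assumes "simplicial_complex K" "finite K" "x \<in> realization K" "y \<in> realization K" "y \<noteq> x"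
  shows "excess (\<Union>K) x y > 0"
proof (rule ccontr)
  let ?V = "\<Union>K"
  have V: "finite ?V" using finite_vertices assms by blast
  assume "\<not> excess ?V x y > 0"
  moreover have "excess ?V x y \<ge> 0" unfolding excess_def by (intro sum_nonneg) auto
  ultimately have "(\<Sum>v\<in>?V. max 0 (y v - x v)) = 0" by (simp add: excess_def)
  then have "max 0 (y v - x v) = 0" if "v \<in> ?V" for v
    using V that by (subst (asm) sum_nonneg_eq_0_iff) auto
  then have le: "0 \<le> x v - y v" if "v \<in> ?V" for v using that by force
  have sub: "{v. z v \<noteq> 0} \<subseteq> ?V" if "z \<in> realization K" for z using realizationD(2)[OF that] by blast
  have "(\<Sum>v\<in>?V. x v - y v) = 0"
    using sum_realization[OF assms(3) V sub[OF assms(3)]] sum_realization[OF assms(4) V sub[OF assms(4)]]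
    by (simp add: sum_subtractf)
  then have "x v - y v = 0" if "v \<in> ?V" for v
    using V le that by (subst (asm) sum_nonneg_eq_0_iff) auto
  moreover have "z v = 0" if "v \<notin> ?V" "z \<in> realization K" for v z
    using that(1) sub[OF that(2)] by blast
  ultimately have "y v = x v" for v using assms(3,4) by (metis eq_iff_diff_eq_0)
  then have "y = x" by (rule ext)
  then show False using assms(5) by simp
qed

text \<open>Compactness of the finitely many singular simplices of \<open>a\<close>. All smaller
  bounds are included because the labelling shrinks \<open>r\<close> further.\<close>

lemma chain_avoiding_point_bound:
  assumes K: "simplicial_complex K" "finite K" and x: "x \<in> realization K"
    and a: "singular_chain p (subtopology (realtop K) (realization K - {x})) a"
  obtains r where "r > 0" "\<And>r'. r' \<le> r \<Longrightarrow> singular_chain p (subtopology (realtop K) {y. r' \<le> excess (\<Union>K) x y}) a"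
proof -
  let ?V = "\<Union>K"
  have V: "finite ?V" using finite_vertices K by blast
  have "\<exists>r>0. \<forall>t\<in>standard_simplex p. r \<le> excess ?V x (s t)" if s: "s \<in> Poly_Mapping.keys a" for s
  proof -
    have ss: "singular_simplex p (realtop K) s" "s ` standard_simplex p \<subseteq> realization K - {x}"
      using a s unfolding singular_chain_subtopology by (auto simp only: singular_chain_def)
    then have "continuous_map (subtopology (powertop_real UNIV) (standard_simplex p)) euclideanreal (excess ?V x \<circ> s)"
      using continuous_map_compose[OF _ continuous_map_excess[OF V]] unfolding singular_simplex_def by blast
    moreover have "compactin (subtopology (powertop_real UNIV) (standard_simplex p)) (standard_simplex p)"
      using compactin_standard_simplex by (simp add: compactin_subtopology)
    ultimately have "compactin euclideanreal ((excess ?V x \<circ> s) ` standard_simplex p)"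
      by (intro image_compactin)
    then have "compact ((excess ?V x \<circ> s) ` standard_simplex p)" by simp
    then obtain t where t: "t \<in> standard_simplex p"
      "\<forall>t'\<in>standard_simplex p. excess ?V x (s t) \<le> excess ?V x (s t')"
      using compact_attains_inf[of "(excess ?V x \<circ> s) ` standard_simplex p"] nonempty_standard_simplex
      by auto
    moreover have "s t \<in> realization K" "s t \<noteq> x" using ss t by auto
    then have "excess ?V x (s t) > 0" using excess_pos K x by blast
    ultimately show ?thesis by blast
  qed
  then obtain r where r: "\<And>s. s \<in> Poly_Mapping.keys a \<Longrightarrow> r s > 0 \<and> (\<forall>t\<in>standard_simplex p. r s \<le> excess ?V x (s t))"
    by metis
  \<comment> \<open>The extra 1 covers the zero chain, which has no keys.\<close>
  define r0 where "r0 = Min (insert 1 (r ` Poly_Mapping.keys a))"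
  have r0: "r0 > 0" "\<And>s. s \<in> Poly_Mapping.keys a \<Longrightarrow> r0 \<le> r s"
    using r by (auto simp: r0_def)
  show ?thesis
  proof (rule that[OF r0(1)])
    fix r' assume "r' \<le> r0"
    then have "s t \<in> {y. r' \<le> excess ?V x y}" if "s \<in> Poly_Mapping.keys a" "t \<in> standard_simplex p" for s t
      using r[OF that(1)] r0(2)[OF that(1)] that(2) by fastforce
    then show "singular_chain p (subtopology (realtop K) {y. r' \<le> excess ?V x y}) a"
      using a unfolding singular_chain_subtopology by blast
  qed
qed

text \<open>
  Away from the barycenter \<open>x\<close> a point \<open>y\<close> is labelled by a vertex with \<open>y v - x v\<close> bounded below.
  If the labels of a small set covered \<open>\<sigma>\<close>, a point of it would exceed \<open>x\<close> in
  all coordinates of \<open>\<sigma>\<close>, although those of \<open>x\<close> already sum to 1.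
\<close>

lemma labelling_exists:
  assumes K: "simplicial_complex K" "finite K" and \<sigma>: "\<sigma> \<in> K" "\<sigma> \<noteq> {}"
    and a: "singular_chain p (subtopology (realtop K) (realization K - {barycenter \<sigma>})) a"
  obtains \<phi> \<C> A where "\<And>y. y \<in> realization K \<Longrightarrow> y (\<phi> y) \<noteq> 0"
    "\<And>U. U \<in> \<C> \<Longrightarrow> openin (realtop K) U" "realization K \<subseteq> \<Union>\<C>"
    "singular_chain p (subtopology (realtop K) A) a"
    "\<And>U Y. \<lbrakk>U \<in> \<C>; Y \<subseteq> U\<rbrakk> \<Longrightarrow> \<phi> ` Y \<in> K"
    "\<And>U Y. \<lbrakk>U \<in> \<C>; Y \<subseteq> U \<inter> A\<rbrakk> \<Longrightarrow> \<not> \<sigma> \<subseteq> \<phi> ` Y"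
proof -
  let ?V = "\<Union>K" and ?x = "barycenter \<sigma>"
  have V: "finite ?V" "?V \<noteq> {}" "card ?V > 0" using finite_vertices K \<sigma> by (auto simp: card_gt_0_iff)
  have f\<sigma>: "finite \<sigma>" using K \<sigma> simplicial_complex_finite by blast
  have x: "?x \<in> realization K" using barycenter_in_realization K \<sigma> by blast
  have sub: "{v. y v \<noteq> 0} \<subseteq> ?V" if "y \<in> realization K" for y using realizationD(2)[OF that] by blast
  obtain r1 where r1: "r1 > 0"
    "\<And>r'. r' \<le> r1 \<Longrightarrow> singular_chain p (subtopology (realtop K) {y. r' \<le> excess ?V ?x y}) a"
    using chain_avoiding_point_bound[OF K x a] by metis
  obtain v0 where v0: "v0 \<in> \<sigma>" using \<sigma> by blast
  have xv0: "?x v0 > 0" using v0 f\<sigma> by (auto simp: barycenter_def card_gt_0_iff)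
  \<comment> \<open>Half of the coordinate at \<open>v0\<close> keeps the default label
    \<open>v0\<close> well inside the support of every point outside \<open>A\<close>.\<close>
  define r where "r = min r1 (?x v0 / 2)"
  have r: "r > 0" "r \<le> r1" "r \<le> ?x v0 / 2" using r1 xv0 by (auto simp: r_def)
  \<comment> \<open>Spread over all vertices, an excess of at least \<open>r\<close> forces some
    coordinate to exceed that of the barycenter by at least \<open>c\<close>.\<close>
  define c where "c = r / card ?V"
  have c: "c > 0" "c \<le> r" "c * card ?V = r"
    using r V by (auto simp: c_def divide_le_eq mult_le_cancel_left1 Suc_le_eq)
  define A where "A = {y. r \<le> excess ?V ?x y}"
  define \<phi> where "\<phi> y = (if y \<in> A then SOME v. v \<in> ?V \<and> c \<le> y v - ?x v else v0)" for y
  have \<phi>A: "c \<le> y (\<phi> y) - ?x (\<phi> y)" if "y \<in> A" for y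
  proof -
    have "\<exists>v. v \<in> ?V \<and> c \<le> y v - ?x v"
    proof (rule ccontr)
      assume "\<nexists>v. v \<in> ?V \<and> c \<le> y v - ?x v"
      then have "max 0 (y v - ?x v) < c" if "v \<in> ?V" for v using c(1) that by force
      then have "excess ?V ?x y < (\<Sum>v\<in>?V. c)"
        unfolding excess_def by (intro sum_strict_mono V(1,2))
      also have "\<dots> = r" using c(3) by (simp add: mult.commute)
      finally show False using that by (simp add: A_def)
    qed
    from someI_ex[OF this] show ?thesis using that by (simp add: \<phi>_def)
  qed
  have \<phi>c: "c \<le> y (\<phi> y)" if y: "y \<in> realization K" for y
  proof (cases "y \<in> A")
    case True
    then show ?thesis using \<phi>A[OF True] realizationD(1)[OF x, of "\<phi> y"] by linarith
  next
    case False
    \<comment> \<open>What \<open>y\<close> loses at \<open>v0\<close> is at most its excess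
      elsewhere, hence less than \<open>r\<close>, and at least \<open>c\<close> remains
      there.\<close>
    have "(\<Sum>v\<in>?V. y v - ?x v) = 0"
      using sum_realization[OF y V(1) sub[OF y]] sum_realization[OF x V(1) sub[OF x]] by (simp add: sum_subtractf)
    moreover have "(\<Sum>v\<in>?V. y v - ?x v) = (y v0 - ?x v0) + (\<Sum>v\<in>?V-{v0}. y v - ?x v)"
      using v0 \<sigma> V by (subst sum.remove[of _ v0]) auto
    moreover have "(\<Sum>v\<in>?V-{v0}. y v - ?x v) \<le> (\<Sum>v\<in>?V-{v0}. max 0 (y v - ?x v))"
      by (intro sum_mono) auto
    moreover have "(\<Sum>v\<in>?V-{v0}. max 0 (y v - ?x v)) \<le> excess ?V ?x y"
      unfolding excess_def using V by (intro sum_mono2) auto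
    moreover have "excess ?V ?x y < r" using False by (auto simp: A_def)
    ultimately have "y v0 > ?x v0 - r" by linarith
    then have "c \<le> y v0" using r c by linarith
    then show ?thesis using False by (simp add: \<phi>_def)
  qed
  \<comment> \<open>Radius \<open>c / 2\<close> makes two points of the same set differ by less than
    \<open>c\<close>, so the label of one is a vertex in the support of the other.\<close>
  define U where "U y0 = {y \<in> realization K. \<forall>v\<in>?V. \<bar>y v - y0 v\<bar> < c / 2}" for y0
  have close: "\<bar>y v - y' v\<bar> < c" if "y \<in> U y0" "y' \<in> U y0" "v \<in> ?V" for y y' y0 v
  proof -
    have "\<bar>y v - y0 v\<bar> < c / 2" "\<bar>y' v - y0 v\<bar> < c / 2" using that by (auto simp: U_def)
    then show ?thesis by linarith
  qed
  have in_V: "\<phi> y \<in> ?V" if "y \<in> realization K" for y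
  proof -
    have "y (\<phi> y) \<noteq> 0" using \<phi>c[OF that] c(1) by auto
    then show ?thesis using sub[OF that] by blast
  qed
  show ?thesis
  proof (rule that[of \<phi> "U ` realization K" A])
    show "y (\<phi> y) \<noteq> 0" if "y \<in> realization K" for y using \<phi>c[OF that] c(1) by auto
    show "openin (realtop K) W" if W': "W \<in> U ` realization K" for W
    proof -
      obtain y0 where W: "W = U y0" using W' by blast
      have "openin (realtop K) {y \<in> topspace (realtop K). y v \<in> ball (y0 v) (c/2)}" for v
        by (rule openin_continuous_map_preimage[OF continuous_map_realtop_coord]) simp
      then have "openin (realtop K) (\<Inter>v\<in>?V. {y \<in> topspace (realtop K). y v \<in> ball (y0 v) (c/2)})"
        using V by (intro openin_INT2) auto
      moreover have "(\<Inter>v\<in>?V. {y \<in> topspace (realtop K). y v \<in> ball (y0 v) (c/2)}) = W"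
        using V unfolding W U_def by (auto simp: dist_real_def abs_minus_commute)
      ultimately show ?thesis by simp
    qed
    show "realization K \<subseteq> \<Union>(U ` realization K)" using c(1) by (auto simp: U_def)
    show "singular_chain p (subtopology (realtop K) A) a" unfolding A_def using r1(2) r(2) by blast
    show "\<phi> ` Y \<in> K" if W': "W \<in> U ` realization K" and Y: "Y \<subseteq> W" for W Y
    proof (cases "Y = {}")
      case True
      then show ?thesis using simplicial_complex_subset[OF K(1) \<sigma>(1)] by auto
    next
      case False
      then obtain y where y: "y \<in> Y" by blast
      obtain y0 where W: "W = U y0" using W' by blast
      have YK: "Y \<subseteq> realization K" using Y W by (auto simp: U_def)
      have "\<phi> y' \<in> {v. y v \<noteq> 0}" if y': "y' \<in> Y" for y'
      proof -
        have "\<bar>y' (\<phi> y') - y (\<phi> y')\<bar> < c"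
          using y y' YK Y W in_V by (intro close[of _ y0]) auto
        then show ?thesis using \<phi>c[of y'] y' YK by auto
      qed
      then have "\<phi> ` Y \<subseteq> {v. y v \<noteq> 0}" by blast
      then show ?thesis using realizationD(2) y YK simplicial_complex_subset[OF K(1)] by blast
    qed
    show "\<not> \<sigma> \<subseteq> \<phi> ` Y" if W': "W \<in> U ` realization K" and Y: "Y \<subseteq> W \<inter> A" for W Y
    proof
      assume s: "\<sigma> \<subseteq> \<phi> ` Y"
      then obtain y where y: "y \<in> Y" using \<sigma>(2) by blast
      obtain y0 where W: "W = U y0" using W' by blast
      have YK: "Y \<subseteq> realization K" using Y W by (auto simp: U_def)
      have *: "?x v < y v" if v: "v \<in> \<sigma>" for v
      proof -
        obtain y' where y': "y' \<in> Y" "v = \<phi> y'" using s v by blast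
        have "\<bar>y' v - y v\<bar> < c"
          using y y' YK Y W in_V by (intro close[of _ y0]) auto
        moreover have "c \<le> y' v - ?x v" using \<phi>A y' Y by blast
        ultimately show ?thesis by linarith
      qed
      have yK: "y \<in> realization K" using y YK by blast
      from * have "(\<Sum>v\<in>\<sigma>. ?x v) < (\<Sum>v\<in>\<sigma>. y v)" using f\<sigma> \<sigma>(2) by (intro sum_strict_mono) auto
      also have "\<dots> \<le> (\<Sum>v\<in>?V. y v)" using V(1) \<sigma>(1) realizationD(1)[OF yK] by (intro sum_mono2) auto
      also have "\<dots> = 1" by (rule sum_realization[OF yK V(1) sub[OF yK]])
      finally show False using sum_barycenter[OF f\<sigma> order_refl \<sigma>(2)] by simp
    qed
  qed
qed

definition lin_chain :: "'v::linorder set set \<Rightarrow> 'v set \<Rightarrow> nat \<Rightarrow> ('v set \<Rightarrow> int) \<Rightarrow> ('v \<Rightarrow> real) chain" where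
  "lin_chain K \<sigma> p c = (\<Sum>\<tau>\<in>cofaces K \<sigma> (Suc p). frag_cmul (c \<tau>) (frag_of (lin_simplex p \<tau>)))"

lemma singular_chain_lin_chain:
  assumes "simplicial_complex K" shows "singular_chain p (realtop K) (lin_chain K \<sigma> p c)"
  unfolding lin_chain_def using singular_simplex_lin_simplex[OF assms]
  by (intro singular_chain_sum singular_chain_cmul) (auto simp: singular_chain_of cofaces_def)

text \<open>Subdividing and labelling is a mod 2 chain map that fixes the linear simplices. It kills
  the doubled chain, sends \<open>a\<close> to simplices not containing \<open>\<sigma>\<close>, and
  turns \<open>w\<close> into the bounding chain. Here \<open>n\<close> is the coefficient
  function.\<close>

lemma lin_chain_bounds:
  fixes K :: "'v::linorder set set"
  assumes K: "simplicial_complex K" "finite K" and \<sigma>: "\<sigma> \<in> K" "\<sigma> \<noteq> {}"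
    and eq: "lin_chain K \<sigma> p n = frag_cmul 2 e + chain_boundary (Suc p) w + a"
    and w: "singular_chain (Suc p) (realtop K) w"
    and a: "singular_chain p (subtopology (realtop K) (realization K - {barycenter \<sigma>})) a"
  shows "\<exists>u. \<forall>\<tau>\<in>cofaces K \<sigma> (Suc p). bdry2 K u \<tau> = of_int (n \<tau>)"
proof -
  obtain \<phi> \<C> A where \<phi>: "\<And>y. y \<in> realization K \<Longrightarrow> y (\<phi> y) \<noteq> 0"
    and \<C>: "\<And>U. U \<in> \<C> \<Longrightarrow> openin (realtop K) U" "topspace (realtop K) \<subseteq> \<Union>\<C>"
    and A: "singular_chain p (subtopology (realtop K) A) a"
    and small: "\<And>U Y. \<lbrakk>U \<in> \<C>; Y \<subseteq> U\<rbrakk> \<Longrightarrow> \<phi> ` Y \<in> K"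
    and avoid: "\<And>U Y. \<lbrakk>U \<in> \<C>; Y \<subseteq> U \<inter> A\<rbrakk> \<Longrightarrow> \<not> \<sigma> \<subseteq> \<phi> ` Y"
    using labelling_exists[OF K \<sigma> a] by (metis topspace_realtop)
  obtain m1 where m1: "\<And>m f. \<lbrakk>m1 \<le> m; f \<in> Poly_Mapping.keys (Sd (Suc p) m w)\<rbrakk>
      \<Longrightarrow> \<exists>V\<in>\<C>. f \<in> standard_simplex (Suc p) \<rightarrow> V"
    using sufficient_iterated_singular_subdivision_exists[OF \<C> w] by blast
  have a': "singular_chain p (realtop K) a" using A by (simp add: singular_chain_subtopology)
  obtain m2 where m2: "\<And>m f. \<lbrakk>m2 \<le> m; f \<in> Poly_Mapping.keys (Sd p m a)\<rbrakk>
      \<Longrightarrow> \<exists>V\<in>\<C>. f \<in> standard_simplex p \<rightarrow> V"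
    using sufficient_iterated_singular_subdivision_exists[OF \<C> a'] by blast
  define m where "m = max m1 m2"
  have labels: "labels \<phi> q s = \<phi> ` ((\<lambda>j. s (\<lambda>i. if i = j then 1 else 0)) ` {..q})" for q s
    by (simp add: labels_def image_image)
  have W: "labels \<phi> (Suc p) s \<in> K" if s: "s \<in> Poly_Mapping.keys (Sd (Suc p) m w)" for s
  proof -
    obtain V where V: "V \<in> \<C>" "s \<in> standard_simplex (Suc p) \<rightarrow> V" using m1[OF _ s] by (auto simp: m_def)
    show ?thesis unfolding labels by (rule small[OF V(1)]) (use V(2) in auto)
  qed
  have Aa: "\<not> \<sigma> \<subseteq> labels \<phi> p s" if s: "s \<in> Poly_Mapping.keys (Sd p m a)" for s
  proof -
    obtain V where V: "V \<in> \<C>" "s \<in> standard_simplex p \<rightarrow> V" using m2[OF _ s] by (auto simp: m_def)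
    moreover have "s ` standard_simplex p \<subseteq> A"
      using singular_chain_Sd[OF A, of m] s unfolding singular_chain_subtopology by blast
    ultimately show ?thesis unfolding labels by (intro avoid[OF V(1)]) auto
  qed
  let ?u = "\<lambda>\<rho>. mod2_eval (has_labels \<phi> (Suc p) \<rho>) (Sd (Suc p) m w)"
  have "bdry2 K ?u \<tau> = of_int (n \<tau>)" if \<tau>: "\<tau> \<in> cofaces K \<sigma> (Suc p)" for \<tau>
  proof -
    have \<tau>': "\<tau> \<in> K" "\<sigma> \<subseteq> \<tau>" "card \<tau> = Suc p" "finite \<tau>"
      using \<tau> K simplicial_complex_finite by (auto simp: cofaces_def)
    let ?ev = "\<lambda>c. mod2_eval (has_labels \<phi> p \<tau>) (Sd p m c)"
    have "?ev (lin_chain K \<sigma> p n) = (\<Sum>\<rho>\<in>cofaces K \<sigma> (Suc p). of_int (n \<rho>) * ?ev (frag_of (lin_simplex p \<rho>)))"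
      by (simp add: lin_chain_def Sd_sum Sd_cmul mod2_eval_sum mod2_eval_cmul)
    also have "\<dots> = (\<Sum>\<rho>\<in>cofaces K \<sigma> (Suc p). of_int (n \<rho>) * of_bool (\<tau> = \<rho>))"
    proof (rule sum.cong[OF refl])
      fix \<rho> assume "\<rho> \<in> cofaces K \<sigma> (Suc p)"
      then have "?ev (frag_of (lin_simplex p \<rho>)) = of_bool (\<tau> = \<rho>)"
        using \<phi> \<tau>'(3) by (intro sperner[OF K]) (auto simp: cofaces_def)
      then show "of_int (n \<rho>) * ?ev (frag_of (lin_simplex p \<rho>)) = of_int (n \<rho>) * of_bool (\<tau> = \<rho>)"
        by simp
    qed
    also have "\<dots> = of_int (n \<tau>)"
      using \<tau> by (subst sum.remove[of _ \<tau>]) (auto simp: finite_cofaces K intro!: sum.neutral)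
    finally have 1: "?ev (lin_chain K \<sigma> p n) = of_int (n \<tau>)" .
    have "?ev a = 0" using Aa \<tau>'(2) by (intro mod2_eval_eq_0) auto
    moreover have "?ev (frag_cmul 2 e) = 0" by (simp add: Sd_cmul mod2_eval_cmul)
    moreover have "?ev (chain_boundary (Suc p) w) = bdry2 K ?u \<tau>"
      unfolding chain_boundary_Sd[OF w, symmetric]
      using K \<tau>' W by (intro mod2_eval_labels_boundary) auto
    ultimately have "?ev (lin_chain K \<sigma> p n) = bdry2 K ?u \<tau>" by (simp add: eq Sd_add mod2_eval_add)
    then show ?thesis using 1 by simp
  qed
  then show ?thesis by blast
qed


section \<open>Local acyclicity from local singular homology\<close>

text \<open>Division with remainder of each coefficient by two; a remainder survives exactly where
  the coefficient is odd.\<close>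

lemma even_odd_split:
  fixes c :: "'a \<Rightarrow>\<^sub>0 int"
  assumes "\<And>s. s \<in> Poly_Mapping.keys c \<Longrightarrow> odd (Poly_Mapping.lookup c s) \<Longrightarrow> s \<in> T"
  obtains b a where "c = frag_cmul 2 b + a" "Poly_Mapping.keys b \<subseteq> Poly_Mapping.keys c"
    "Poly_Mapping.keys a \<subseteq> T"
proof
  let ?l = "Poly_Mapping.lookup c" and ?S = "Poly_Mapping.keys c"
  define b where "b = (\<Sum>s\<in>?S. frag_cmul (?l s div 2) (frag_of s))"
  define a where "a = (\<Sum>s\<in>?S. frag_cmul (?l s mod 2) (frag_of s))"
  have "c = (\<Sum>s\<in>?S. frag_cmul (?l s) (frag_of s))"
    using frag_expansion[of c] by (simp add: frag_extend_def)
  also have "\<dots> = (\<Sum>s\<in>?S. frag_cmul (2 * (?l s div 2) + ?l s mod 2) (frag_of s))" by simp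
  also have "\<dots> = (\<Sum>s\<in>?S. frag_cmul 2 (frag_cmul (?l s div 2) (frag_of s)) + frag_cmul (?l s mod 2) (frag_of s))"
    by (simp only: frag_cmul_distrib frag_cmul_cmul)
  also have "\<dots> = frag_cmul 2 b + a" by (simp only: a_def b_def sum.distrib frag_cmul_sum)
  finally show "c = frag_cmul 2 b + a" .
  show "Poly_Mapping.keys b \<subseteq> ?S" unfolding b_def using keys_sum by (rule order_trans) auto
  show "Poly_Mapping.keys a \<subseteq> T" unfolding a_def using keys_sum
    by (rule order_trans) (use assms in \<open>auto simp: keys_cmul_iff odd_iff_mod_2_eq_one split: if_splits\<close>)
qed

lemma trivial_relative_homology_imp_relboundary:
  assumes "trivial_group (relative_homology_group (int p) X S)" "singular_relcycle p X S c"
  shows "singular_relboundary p X S c"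
proof -
  have "homologous_rel_set p X S c \<in> carrier (relative_homology_group (int p) X S)"
    using assms(2) by (auto simp: carrier_relative_homology_group)
  then have "homologous_rel_set p X S c = singular_relboundary_set p X S"
    using assms(1) by (simp add: trivial_group_def)
  then show ?thesis by (simp only: homologous_rel_set_eq_relboundary)
qed

text \<open>Distinct vertex sets give distinct linear simplices, so no coefficients merge, and the
  signs disappear mod 2.\<close>

lemma lookup_boundary_lin_chain:
  assumes K: "simplicial_complex K" "finite K" and \<rho>: "\<rho> \<in> cofaces K \<sigma> (Suc q)"
  shows "of_int (Poly_Mapping.lookup (chain_boundary (Suc q) (lin_chain K \<sigma> (Suc q) n)) (lin_simplex q \<rho>))
       = bdry2 K (\<lambda>\<tau>. of_int (n \<tau>)) \<rho>"
proof -
  have f: "finite \<tau>" if "\<tau> \<in> K" for \<tau> using that K simplicial_complex_finite by blast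
  have \<rho>': "\<rho> \<in> K" "\<sigma> \<subseteq> \<rho>" "card \<rho> = Suc q" using \<rho> by (auto simp: cofaces_def)
  let ?C = "cofaces K \<sigma> (Suc (Suc q))"
  let ?ev = "mod2_eval (\<lambda>s. of_bool (s = lin_simplex q \<rho>))"
  have "?ev (chain_boundary (Suc q) (lin_chain K \<sigma> (Suc q) n))
      = (\<Sum>\<tau>\<in>?C. of_int (n \<tau>) * ?ev (chain_boundary (Suc q) (frag_of (lin_simplex (Suc q) \<tau>))))"
    by (simp add: lin_chain_def chain_boundary_sum chain_boundary_cmul mod2_eval_sum mod2_eval_cmul)
  also have "\<dots> = (\<Sum>\<tau>\<in>?C. of_int (n \<tau>) * (\<Sum>u\<in>\<tau>-\<sigma>. of_bool (\<tau>-{u} = \<rho>)))"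
  proof (intro sum.cong refl arg_cong2[where f="(*)"])
    fix \<tau> assume "\<tau> \<in> ?C"
    then have \<tau>: "\<tau> \<in> K" "\<sigma> \<subseteq> \<tau>" "card \<tau> = Suc (Suc q)" by (auto simp: cofaces_def)
    have "?ev (chain_boundary (Suc q) (frag_of (lin_simplex (Suc q) \<tau>)))
        = (\<Sum>u\<in>\<tau>. of_bool (lin_simplex q (\<tau>-{u}) = lin_simplex q \<rho>))"
      by (simp add: chain_boundary_lin_simplex f \<tau> mod2_eval_sum mod2_eval_cmul bit_of_int)
    also have "\<dots> = (\<Sum>u\<in>\<tau>. of_bool (\<tau>-{u} = \<rho>))"
      using f \<tau> \<rho>' by (intro sum.cong) (auto simp: lin_simplex_inject)
    \<comment> \<open>Omitting a vertex of \<open>\<sigma>\<close> cannot give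
      \<open>\<rho>\<close>, which contains \<open>\<sigma>\<close>.\<close>
    also have "\<dots> = (\<Sum>u\<in>\<tau>-\<sigma>. of_bool (\<tau>-{u} = \<rho>))"
      using f \<tau> \<rho>' by (intro sum.mono_neutral_right) auto
    finally show "?ev (chain_boundary (Suc q) (frag_of (lin_simplex (Suc q) \<tau>)))
      = (\<Sum>u\<in>\<tau>-\<sigma>. of_bool (\<tau>-{u} = \<rho>))" .
  qed
  also have "\<dots> = (\<Sum>\<tau>\<in>cofaces K \<sigma> (Suc q). of_bool (\<tau> = \<rho>) * bdry2 K (\<lambda>\<tau>. of_int (n \<tau>)) \<tau>)"
    by (rule bdry2_adjoint[OF K, symmetric])
  also have "\<dots> = bdry2 K (\<lambda>\<tau>. of_int (n \<tau>)) \<rho>"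
    using \<rho> by (subst sum.remove[of _ \<rho>]) (auto simp: finite_cofaces K intro!: sum.neutral)
  finally show ?thesis by (simp add: mod2_eval_lookup)
qed

lemma keys_boundary_lin_chain:
  assumes K: "simplicial_complex K" "finite K"
    and s: "s \<in> Poly_Mapping.keys (chain_boundary (Suc q) (lin_chain K \<sigma> (Suc q) n))"
  obtains \<rho> where "\<rho> \<in> K" "card \<rho> = Suc q" "s = lin_simplex q \<rho>"
proof -
  have "chain_boundary (Suc q) (lin_chain K \<sigma> (Suc q) n)
      = (\<Sum>\<tau>\<in>cofaces K \<sigma> (Suc (Suc q)). frag_cmul (n \<tau>)
          (\<Sum>u\<in>\<tau>. frag_cmul ((-1) ^ vindex \<tau> u) (frag_of (lin_simplex q (\<tau>-{u})))))"
    unfolding lin_chain_def chain_boundary_sum comp_def chain_boundary_cmul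
    using K simplicial_complex_finite
    by (intro sum.cong refl arg_cong2[where f=frag_cmul] chain_boundary_lin_simplex) (auto simp: cofaces_def)
  then have "s \<in> Poly_Mapping.keys (\<Sum>\<tau>\<in>cofaces K \<sigma> (Suc (Suc q)). frag_cmul (n \<tau>)
          (\<Sum>u\<in>\<tau>. frag_cmul ((-1) ^ vindex \<tau> u) (frag_of (lin_simplex q (\<tau>-{u})))))" using s by simp
  then obtain \<tau> where \<tau>: "\<tau> \<in> cofaces K \<sigma> (Suc (Suc q))" "s \<in> Poly_Mapping.keys (frag_cmul (n \<tau>)
          (\<Sum>u\<in>\<tau>. frag_cmul ((-1) ^ vindex \<tau> u) (frag_of (lin_simplex q (\<tau>-{u})))))"
    by (elim UN_E[OF subsetD[OF keys_sum]])
  then have "s \<in> Poly_Mapping.keys (\<Sum>u\<in>\<tau>. frag_cmul ((-1) ^ vindex \<tau> u) (frag_of (lin_simplex q (\<tau>-{u}))))"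
    using keys_cmul by blast
  then obtain u where u: "u \<in> \<tau>" "s \<in> Poly_Mapping.keys (frag_cmul ((-1) ^ vindex \<tau> u) (frag_of (lin_simplex q (\<tau>-{u}))))"
    using keys_sum by (metis (no_types, lifting) UN_E subsetD)
  then have "s = lin_simplex q (\<tau>-{u})" by auto
  moreover have "\<tau> \<in> K" "card \<tau> = Suc (Suc q)" using \<tau> by (auto simp: cofaces_def)
  ultimately show ?thesis
    using that[of "\<tau>-{u}"] u(1) K simplicial_complex_finite simplicial_complex_subset[of K \<tau> "\<tau>-{u}"] by auto
qed

lemma lin_simplex_avoids_barycenter:
  assumes K: "simplicial_complex K" and \<sigma>: "\<sigma> \<in> K" and \<rho>: "\<rho> \<in> K" "card \<rho> = Suc q" "\<not> \<sigma> \<subseteq> \<rho>"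
  shows "singular_simplex q (subtopology (realtop K) (realization K - {barycenter \<sigma>})) (lin_simplex q \<rho>)"
  unfolding singular_simplex_subtopology
proof
  show "singular_simplex q (realtop K) (lin_simplex q \<rho>)"
    using K \<rho> by (intro singular_simplex_lin_simplex) auto
  have "lin_simplex q \<rho> t \<noteq> barycenter \<sigma>" if "t \<in> standard_simplex q" for t
    using lin_simplex_support[OF that, of \<rho>] barycenter_support[of \<sigma>] simplicial_complex_finite[OF K \<sigma>] \<rho>(3) by auto
  then show "lin_simplex q \<rho> ` standard_simplex q \<subseteq> realization K - {barycenter \<sigma>}"
    using lin_simplex_in_realization[OF K \<rho>(1,2)] by (simp add: image_subset_iff)
qed

text \<open>
  A mod 2 cycle is corrected to an integral one as in the universal coefficient theorem: half of its
  boundary is a relative cycle one degree lower, hence bounds.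
\<close>

lemma lin_chain_lift:
  fixes K :: "'v::linorder set set"
  assumes K: "simplicial_complex K" "finite K" and \<sigma>: "\<sigma> \<in> K" "\<sigma> \<noteq> {}"
    and cyc: "\<And>\<tau>. \<lbrakk>\<tau> \<in> K; \<sigma> \<subseteq> \<tau>; card \<tau> = p\<rbrakk> \<Longrightarrow> bdry2 K (\<lambda>\<tau>. of_int (n \<tau>)) \<tau> = 0"
    and H: "\<And>q. p = Suc q \<Longrightarrow> trivial_group (local_homology (int q) K (barycenter \<sigma>))"
  obtains e \<zeta> where "lin_chain K \<sigma> p n = frag_cmul 2 e + \<zeta>" "singular_chain p (realtop K) e"
    "singular_relcycle p (realtop K) (realization K - {barycenter \<sigma>}) \<zeta>"
proof (cases p)
  case 0
  have "singular_relcycle 0 (realtop K) (realization K - {barycenter \<sigma>}) (lin_chain K \<sigma> 0 n)"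
    using singular_chain_lin_chain[OF K(1)] by (simp add: singular_relcycle chain_boundary_def)
  then show ?thesis using that[of 0] 0 by simp
next
  case (Suc q)
  let ?X = "realtop K" and ?S = "realization K - {barycenter \<sigma>}" and ?c = "lin_chain K \<sigma> p n"
  have cX: "singular_chain p ?X ?c" using singular_chain_lin_chain[OF K(1)] .
  let ?d = "chain_boundary (Suc q) ?c"
  \<comment> \<open>Faces containing \<open>\<sigma>\<close> have even coefficient by the cycle
    condition; odd coefficients sit on faces missing a vertex of \<open>\<sigma>\<close>, which
    avoid the barycenter.\<close>
  have "s \<in> {s. singular_simplex q (subtopology ?X ?S) s}"
    if s: "s \<in> Poly_Mapping.keys ?d" "odd (Poly_Mapping.lookup ?d s)" for s
  proof -
    obtain \<rho> where \<rho>: "\<rho> \<in> K" "card \<rho> = Suc q" "s = lin_simplex q \<rho>"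
      using keys_boundary_lin_chain[OF K] s(1) Suc by blast
    have "\<not> \<sigma> \<subseteq> \<rho>"
    proof
      assume "\<sigma> \<subseteq> \<rho>"
      then have "of_int (Poly_Mapping.lookup ?d s) = (0::bit)"
        using lookup_boundary_lin_chain[OF K, of \<rho> \<sigma> q n] cyc[of \<rho>] \<rho> Suc by (simp add: cofaces_def)
      then show False using s(2) by (simp add: bit_of_int)
    qed
    then show ?thesis using lin_simplex_avoids_barycenter[OF K(1) \<sigma>(1) \<rho>(1,2)] \<rho>(3) by simp
  qed
  then obtain b a where ba: "?d = frag_cmul 2 b + a" "Poly_Mapping.keys b \<subseteq> Poly_Mapping.keys ?d"
    "Poly_Mapping.keys a \<subseteq> {s. singular_simplex q (subtopology ?X ?S) s}"
    using even_odd_split[of ?d] by blast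
  have dX: "singular_chain q ?X ?d" using singular_chain_boundary_alt[of q ?X ?c] cX Suc by simp
  have bX: "singular_chain q ?X b" using dX ba(2) by (auto simp: singular_chain_def)
  have aS: "singular_chain q (subtopology ?X ?S) a" using ba(3) by (simp add: singular_chain_def)
  have "chain_boundary q ?d = 0" using chain_boundary_boundary[OF cX] Suc by simp
  then have "frag_cmul 2 (chain_boundary q b) = - chain_boundary q a"
    by (simp add: ba(1) chain_boundary_add chain_boundary_cmul eq_neg_iff_add_eq_0)
  then have "singular_chain (q - 1) (subtopology ?X ?S) (frag_cmul 2 (chain_boundary q b))"
    using singular_chain_boundary[OF aS] by (simp add: singular_chain_minus)
  \<comment> \<open>Over the integers doubling does not change the support of a chain.\<close>
  then have "singular_chain (q - 1) (subtopology ?X ?S) (chain_boundary q b)"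
    by (auto simp: singular_chain_def)
  then have "singular_relcycle q ?X ?S b" using bX by (simp add: singular_relcycle)
  then have "singular_relboundary q ?X ?S b"
    using trivial_relative_homology_imp_relboundary[OF H[OF Suc]] by simp
  then obtain e a2 where e: "singular_chain (Suc q) ?X e" "singular_chain q (subtopology ?X ?S) a2"
    "chain_boundary (Suc q) e + a2 = b" by (auto simp: singular_relboundary)
  \<comment> \<open>Subtracting \<open>2 e\<close> replaces the even part \<open>2 b\<close> of the
    boundary by \<open>2 a2\<close>, which avoids the barycenter.\<close>
  define \<zeta> where "\<zeta> = ?c - frag_cmul 2 e"
  have "chain_boundary p \<zeta> = ?d - frag_cmul 2 (chain_boundary (Suc q) e)"
    using Suc by (simp add: \<zeta>_def chain_boundary_diff chain_boundary_cmul)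
  also have "\<dots> = frag_cmul 2 a2 + a" by (simp add: ba(1) e(3)[symmetric] frag_cmul_distrib2)
  finally have "singular_chain (p - 1) (subtopology ?X ?S) (chain_boundary p \<zeta>)"
    using aS e(2) Suc by (simp add: singular_chain_add singular_chain_cmul)
  then have "singular_relcycle p ?X ?S \<zeta>"
    using cX e(1) Suc by (simp add: singular_relcycle \<zeta>_def singular_chain_diff singular_chain_cmul)
  then show ?thesis using that[of e \<zeta>] e(1) Suc by (simp add: \<zeta>_def)
qed

text \<open>The lift of \<open>z\<close> to coefficients 0 and 1 becomes, up to a doubled chain, an
  integral relative cycle in degree \<open>k - 1 < n\<close>. It bounds singularly, and
  \<open>lin_chain_bounds\<close> brings the bounding chain back to \<open>K\<close>.\<close>

lemma local_acyclic:
  fixes K :: "'v::linorder set set"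
  assumes K: "simplicial_complex K" "finite K" and \<sigma>: "\<sigma> \<in> K" "\<sigma> \<noteq> {}" and k: "k \<le> n"
    and H: "\<And>q. q < n \<Longrightarrow> trivial_group (local_homology (int q) K (barycenter \<sigma>))"
    and cyc: "\<And>\<tau>. \<lbrakk>\<tau> \<in> K; \<sigma> \<subseteq> \<tau>; Suc (card \<tau>) = k\<rbrakk> \<Longrightarrow> bdry2 K z \<tau> = 0"
  shows "\<exists>u. \<forall>\<tau>\<in>cofaces K \<sigma> k. bdry2 K u \<tau> = z \<tau>"
proof (cases k)
  case 0
  have "cofaces K \<sigma> 0 = {}"
    using \<sigma> K simplicial_complex_finite by (fastforce simp: cofaces_def)
  then show ?thesis using 0 by simp
next
  case (Suc p)
  define m :: "'v set \<Rightarrow> int" where "m \<tau> = of_bool (z \<tau> = 1)" for \<tau>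
  have m: "of_int (m \<tau>) = z \<tau>" for \<tau> by (cases "z \<tau>") (auto simp: m_def)
  obtain e \<zeta> where e: "lin_chain K \<sigma> p m = frag_cmul 2 e + \<zeta>" "singular_chain p (realtop K) e"
    "singular_relcycle p (realtop K) (realization K - {barycenter \<sigma>}) \<zeta>"
    using lin_chain_lift[OF K \<sigma>, of p m] cyc H Suc k by (auto simp: m)
  then have "singular_relboundary p (realtop K) (realization K - {barycenter \<sigma>}) \<zeta>"
    using trivial_relative_homology_imp_relboundary[OF H[of p]] Suc k by simp
  then obtain w a where "singular_chain (Suc p) (realtop K) w"
    "singular_chain p (subtopology (realtop K) (realization K - {barycenter \<sigma>})) a"
    "chain_boundary (Suc p) w + a = \<zeta>" by (auto simp: singular_relboundary)
  then show ?thesis using lin_chain_bounds[OF K \<sigma>, of p m e w a] e(1) Suc by (simp add: m add.assoc)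
qed

section \<open>Ridges lie in at most two facets\<close>

lemma mult_homologous_rel_set:
  assumes "singular_relcycle p X S a" "singular_relcycle p X S b"
  shows "homologous_rel_set p X S a \<otimes>\<^bsub>relative_homology_group (int p) X S\<^esub> homologous_rel_set p X S b
       = homologous_rel_set p X S (a + b)"
proof -
  let ?G = "relcycle_group p X S" and ?H = "singular_relboundary_set p X S"
  have N: "normal ?H ?G" by (rule normal_subgroup_singular_relboundary_relcycle)
  have cos: "?H #>\<^bsub>?G\<^esub> c = homologous_rel_set p X S c" for c
    by (simp add: right_coset_singular_relboundary)
  have "(?H #>\<^bsub>?G\<^esub> a) <#>\<^bsub>?G\<^esub> (?H #>\<^bsub>?G\<^esub> b) = ?H #>\<^bsub>?G\<^esub> (a \<otimes>\<^bsub>?G\<^esub> b)"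
    using assms by (intro normal.rcos_sum[OF N]) auto
  then show ?thesis by (simp add: cos nontrivial_relative_homology_group FactGroup_def)
qed

text \<open>Two integers and their sum cannot all be odd, so one of the three classes is divisible
  by two: H/2H has at most two elements.\<close>

lemma even_class_among_three:
  assumes G: "trivial_group (relative_homology_group (int p) X S) \<or> relative_homology_group (int p) X S \<cong> integer_group"
    and \<zeta>: "singular_relcycle p X S \<zeta>1" "singular_relcycle p X S \<zeta>2"
  obtains \<zeta> \<eta> w a where "\<zeta> \<in> {\<zeta>1, \<zeta>2, \<zeta>1 + \<zeta>2}" "\<zeta> = frag_cmul 2 \<eta> + chain_boundary (Suc p) w + a"
    "singular_chain (Suc p) X w" "singular_chain p (subtopology X S) a"
proof -
  let ?G = "relative_homology_group (int p) X S"
  let ?cl = "homologous_rel_set p X S"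
  have "\<exists>\<zeta>\<in>{\<zeta>1, \<zeta>2, \<zeta>1 + \<zeta>2}. \<exists>\<eta>. singular_relboundary p X S (\<zeta> - frag_cmul 2 \<eta>)"
    using G
  proof
    assume "trivial_group ?G"
    then have "singular_relboundary p X S (\<zeta>1 - frag_cmul 2 0)"
      using trivial_relative_homology_imp_relboundary \<zeta> by simp
    then show ?thesis by blast
  next
    assume "?G \<cong> integer_group"
    then obtain f where f: "f \<in> iso ?G integer_group" unfolding is_iso_def by blast
    then have hom: "f (x \<otimes>\<^bsub>?G\<^esub> y) = f x + f y" if "x \<in> carrier ?G" "y \<in> carrier ?G" for x y
      using that by (auto simp: iso_def hom_def)
    have bij: "bij_betw f (carrier ?G) UNIV" using f by (simp add: iso_def)
    have cl: "?cl c \<in> carrier ?G" if "singular_relcycle p X S c" for c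
      using that by (auto simp: carrier_relative_homology_group)
    have f_add: "f (?cl (a + b)) = f (?cl a) + f (?cl b)"
      if "singular_relcycle p X S a" "singular_relcycle p X S b" for a b
      using hom[OF cl[OF that(1)] cl[OF that(2)]] mult_homologous_rel_set[OF that] by simp
    have "even (f (?cl \<zeta>1)) \<or> even (f (?cl \<zeta>2)) \<or> even (f (?cl (\<zeta>1 + \<zeta>2)))"
      using f_add[OF \<zeta>] by auto
    then obtain \<zeta> where \<zeta>': "\<zeta> \<in> {\<zeta>1, \<zeta>2, \<zeta>1 + \<zeta>2}" "even (f (?cl \<zeta>))" by blast
    then have cyc: "singular_relcycle p X S \<zeta>" using \<zeta> singular_relcycle_add by blast
    obtain k where k: "f (?cl \<zeta>) = 2 * k" using \<zeta>' by blast
    obtain y where y: "y \<in> carrier ?G" "f y = k" using bij by (metis UNIV_I bij_betw_def imageE)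
    obtain \<eta> where \<eta>: "y = ?cl \<eta>" "singular_relcycle p X S \<eta>"
      using y by (auto simp: carrier_relative_homology_group)
    have "f (?cl (\<eta> + \<eta>)) = f (?cl \<zeta>)" using f_add[OF \<eta>(2,2)] y \<eta> k by simp
    then have "?cl (\<eta> + \<eta>) = ?cl \<zeta>"
      using bij cl cyc \<eta>(2) singular_relcycle_add by (metis bij_betw_def inj_onD)
    then have "homologous_rel p X S \<zeta> (\<eta> + \<eta>)" by (simp only: homologous_rel_set_eq) (simp add: homologous_rel_sym)
    moreover have "\<eta> + \<eta> = frag_cmul 2 \<eta>" using frag_cmul_distrib[of 1 1 \<eta>] by simp
    ultimately show ?thesis using \<zeta>'(1) unfolding homologous_rel_def by auto
  qed
  then obtain \<zeta> \<eta> where \<zeta>': "\<zeta> \<in> {\<zeta>1, \<zeta>2, \<zeta>1 + \<zeta>2}" "singular_relboundary p X S (\<zeta> - frag_cmul 2 \<eta>)" by blast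
  then obtain w a where "singular_chain (Suc p) X w" "singular_chain p (subtopology X S) a"
    "chain_boundary (Suc p) w + a = \<zeta> - frag_cmul 2 \<eta>" by (auto simp: singular_relboundary)
  then show ?thesis using \<zeta>'(1) by (intro that[of \<zeta> \<eta> w a]) (auto simp: algebra_simps)
qed

lemma lin_chain_add: "lin_chain K \<sigma> p (\<lambda>\<tau>. a \<tau> + b \<tau>) = lin_chain K \<sigma> p a + lin_chain K \<sigma> p b"
  by (simp add: lin_chain_def frag_cmul_distrib sum.distrib)

text \<open>Three facets on \<open>R\<close> would give the mod 2 cycles \<open>F1 + F2\<close> and
  \<open>F1 + F3\<close>. Lifted to integral cycles, one of them or their sum has an even class and
  therefore bounds mod 2, but no nonzero chain of top-dimensional simplices bounds.\<close>

lemma ridge_bound: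
  fixes K :: "'v::linorder set set"
  assumes K: "simplicial_complex K" "finite K" and dim: "\<And>\<tau>. \<tau> \<in> K \<Longrightarrow> card \<tau> \<le> Suc n"
    and R: "R \<in> K" "card R = n" "R \<noteq> {}"
    and H: "\<And>q. q < n \<Longrightarrow> trivial_group (local_homology (int q) K (barycenter R))"
    and Hn: "trivial_group (local_homology (int n) K (barycenter R)) \<or> local_homology (int n) K (barycenter R) \<cong> integer_group"
  shows "card (cofvs K R) \<le> 2"
proof (rule ccontr)
  let ?X = "realtop K" and ?S = "realization K - {barycenter R}"
  assume "\<not> card (cofvs K R) \<le> 2"
  then obtain T where T: "T \<subseteq> cofvs K R" "card T = 3"
    using obtain_subset_with_card_n[of 3 "cofvs K R"] by auto
  then obtain v1 v2 v3 where v: "T = {v1,v2,v3}" "v1 \<noteq> v2" "v2 \<noteq> v3" "v1 \<noteq> v3" by (auto simp: card_3_iff)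
  define F1 F2 F3 where "F1 = insert v1 R" "F2 = insert v2 R" "F3 = insert v3 R"
  have fR: "finite R" using K R simplicial_complex_finite by blast
  have vR: "v1 \<notin> R" "v2 \<notin> R" "v3 \<notin> R" and FK: "F1 \<in> K" "F2 \<in> K" "F3 \<in> K"
    using T v by (auto simp: cofvs_def F1_F2_F3_def)
  have F: "F1 \<in> cofaces K R (Suc n)" "F2 \<in> cofaces K R (Suc n)" "F3 \<in> cofaces K R (Suc n)"
    using FK vR fR R by (auto simp: cofaces_def F1_F2_F3_def)
  have Fne: "F1 \<noteq> F2" "F2 \<noteq> F3" "F1 \<noteq> F3" using vR v by (auto simp: F1_F2_F3_def)
  define m where "m F \<tau> = (of_bool (\<tau> = F1) + of_bool (\<tau> = F) :: int)" for F \<tau>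
  have cyc: "bdry2 K (\<lambda>\<tau>. of_int (m F \<tau>)) \<tau> = 0"
    if F': "F \<in> cofaces K R (Suc n)" and \<tau>: "\<tau> \<in> K" "R \<subseteq> \<tau>" "card \<tau> = n" for F \<tau>
  proof -
    have "\<tau> = R" using \<tau> R card_subset_eq K simplicial_complex_finite by metis
    then show ?thesis using F' F(1) R
      by (simp add: m_def bdry2_add bdry2_single K cofaces_def)
  qed
  obtain e1 \<zeta>1 where 1: "lin_chain K R n (m F2) = frag_cmul 2 e1 + \<zeta>1" "singular_relcycle n ?X ?S \<zeta>1"
    using lin_chain_lift[OF K R(1,3), of n "m F2"] cyc[OF F(2)] H by (metis lessI)
  obtain e2 \<zeta>2 where 2: "lin_chain K R n (m F3) = frag_cmul 2 e2 + \<zeta>2" "singular_relcycle n ?X ?S \<zeta>2"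
    using lin_chain_lift[OF K R(1,3), of n "m F3"] cyc[OF F(3)] H by (metis lessI)
  obtain \<zeta> \<eta> w a where \<zeta>: "\<zeta> \<in> {\<zeta>1, \<zeta>2, \<zeta>1 + \<zeta>2}" "\<zeta> = frag_cmul 2 \<eta> + chain_boundary (Suc n) w + a"
    "singular_chain (Suc n) ?X w" "singular_chain n (subtopology ?X ?S) a"
    by (rule even_class_among_three[OF Hn[unfolded topspace_realtop] 1(2) 2(2)])
  have no: False if eq: "lin_chain K R n c = frag_cmul 2 e + \<zeta>" and c: "F \<in> cofaces K R (Suc n)" "odd (c F)" for c e F
  proof -
    have "lin_chain K R n c = frag_cmul 2 (e + \<eta>) + chain_boundary (Suc n) w + a"
      using eq \<zeta>(2) by (simp add: frag_cmul_distrib2 add_ac)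
    then obtain u where "\<forall>\<tau>\<in>cofaces K R (Suc n). bdry2 K u \<tau> = of_int (c \<tau>)"
      using lin_chain_bounds[OF K R(1,3) _ \<zeta>(3,4)] by blast
    then have "bdry2 K u F = 1" using c by (simp add: bit_of_int)
    moreover have "cofvs K F = {}"
    proof -
      have "finite F" "card F = Suc n" using c K simplicial_complex_finite by (auto simp: cofaces_def)
      then have False if "v \<in> cofvs K F" for v using dim[of "insert v F"] that by (auto simp: cofvs_def)
      then show ?thesis by blast
    qed
    ultimately show False by (simp add: bdry2_def)
  qed
  have 3: "lin_chain K R n (\<lambda>\<tau>. m F2 \<tau> + m F3 \<tau>) = frag_cmul 2 (e1 + e2) + (\<zeta>1 + \<zeta>2)"
    unfolding lin_chain_add 1(1) 2(1) by (simp add: frag_cmul_distrib2 add_ac)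
  consider "\<zeta> = \<zeta>1" | "\<zeta> = \<zeta>2" | "\<zeta> = \<zeta>1 + \<zeta>2" using \<zeta>(1) by blast
  then show False
  proof cases
    case 1 then show False using no[OF _ F(1), of "m F2" e1] \<open>lin_chain K R n (m F2) = _\<close> Fne by (simp add: m_def)
  next
    case 2 then show False using no[OF _ F(1), of "m F3" e2] \<open>lin_chain K R n (m F3) = _\<close> Fne by (simp add: m_def)
  next
    \<comment> \<open>In the sum the coefficient of \<open>F1\<close> is 2, so the odd coefficient
      is read off at \<open>F2\<close>.\<close>
    case 3 then show False
      using no[OF _ F(2), of "\<lambda>\<tau>. m F2 \<tau> + m F3 \<tau>" "e1 + e2"] \<open>lin_chain K R n (\<lambda>\<tau>. m F2 \<tau> + m F3 \<tau>) = _\<close> Fne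
      by (simp add: m_def)
  qed
qed


section \<open>The augmental chain complex\<close>

lemma sboundary_void:
  "sboundary K {} c \<tau> = (if \<tau> \<in> K then \<Sum>v\<in>cofvs K \<tau>. (-1) ^ card {w\<in>\<tau>. w < v} * c (insert v \<tau>) else 0)"
  by (simp add: sboundary_def cofvs_def)

text \<open>The two orders of adding \<open>v\<close> and \<open>w\<close> cancel, because the
  larger of them gains the other as a predecessor.\<close>

lemma sboundary_sboundary:
  assumes K: "simplicial_complex K" "finite K" shows "sboundary K {} (sboundary K {} c) = (\<lambda>_. 0)"
proof
  fix \<tau>
  show "sboundary K {} (sboundary K {} c) \<tau> = 0"
  proof (cases "\<tau> \<in> K")
    case True
    have f: "finite \<tau>" using True K simplicial_complex_finite by blast
    let ?s = "\<lambda>\<tau> v. (-1::int) ^ card {w\<in>\<tau>. w < v}"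
    let ?P = "Sigma (cofvs K \<tau>) (\<lambda>v. cofvs K (insert v \<tau>))"
    define g where "g v w = ?s \<tau> v * (?s (insert v \<tau>) w * c (insert w (insert v \<tau>)))" for v w
    have "sboundary K {} (sboundary K {} c) \<tau> = (\<Sum>v\<in>cofvs K \<tau>. \<Sum>w\<in>cofvs K (insert v \<tau>). g v w)"
      using True by (auto simp: sboundary_void sum_distrib_left g_def cofvs_def intro!: sum.cong)
    also have "\<dots> = (\<Sum>(v,w)\<in>?P. g v w)" by (rule sum.Sigma) (auto simp: finite_cofvs K)
    finally have 1: "sboundary K {} (sboundary K {} c) \<tau> = (\<Sum>(v,w)\<in>?P. g v w)" .
    have swap: "(w,v) \<in> ?P" if "(v,w) \<in> ?P" for v w
      using that simplicial_complex_subset[OF K(1), of "insert w (insert v \<tau>)" "insert w \<tau>"]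
      by (auto simp: cofvs_def insert_commute)
    have "(\<Sum>(v,w)\<in>?P. g v w) = (\<Sum>(v,w)\<in>?P. g w v)"
      by (rule sum.reindex_bij_witness[where i="\<lambda>(v,w). (w,v)" and j="\<lambda>(v,w). (w,v)"]) (use swap in auto)
    also have "\<dots> = (\<Sum>(v,w)\<in>?P. - g v w)"
    proof (rule sum.cong[OF refl], clarify)
      fix v w assume "v \<in> cofvs K \<tau>" "w \<in> cofvs K (insert v \<tau>)"
      then have vw: "v \<notin> \<tau>" "w \<notin> \<tau>" "v \<noteq> w" by (auto simp: cofvs_def)
      have ins: "?s (insert x \<tau>) y = (if x < y then - ?s \<tau> y else ?s \<tau> y)" if "x \<notin> \<tau>" for x y
      proof -
        have "{z \<in> insert x \<tau>. z < y} = (if x < y then insert x {z\<in>\<tau>. z < y} else {z\<in>\<tau>. z < y})" by auto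
        then show ?thesis using that f by simp
      qed
      have comm: "insert w (insert v \<tau>) = insert v (insert w \<tau>)" by (rule insert_commute)
      consider "v < w" "\<not> w < v" | "w < v" "\<not> v < w" using vw(3) by fastforce
      then show "g w v = - g v w"
        unfolding g_def ins[OF vw(1)] ins[OF vw(2)] comm by cases simp_all
    qed
    also have "\<dots> = - (\<Sum>(v,w)\<in>?P. g v w)" by (simp add: sum_negf[symmetric] case_prod_unfold)
    finally show ?thesis using 1 by simp
  qed (simp add: sboundary_def)
qed

lemma bdry2_of_int:
  assumes "\<tau> \<in> K" shows "bdry2 K (\<lambda>\<rho>. of_int (c \<rho>)) \<tau> = of_int (sboundary K {} c \<tau>)"
proof -
  have "of_int ((-1) ^ k * x) = (of_int x :: bit)" for k x by (simp add: bit_of_int)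
  then show ?thesis using assms by (simp add: sboundary_void bdry2_def)
qed

lemma sboundary_cmul: "sboundary K L (\<lambda>\<sigma>. a * c \<sigma>) = (\<lambda>\<sigma>. a * sboundary K L c \<sigma>)"
  by (rule ext) (simp add: sboundary_def sum_distrib_left mult.left_commute)

lemma sboundary_add: "sboundary K L (\<lambda>\<sigma>. c \<sigma> + d \<sigma>) = (\<lambda>\<sigma>. sboundary K L c \<sigma> + sboundary K L d \<sigma>)"
  by (rule ext) (simp add: sboundary_def sum.distrib distrib_left)

lemma sboundary_zero: "sboundary K L (\<lambda>\<sigma>. 0) = (\<lambda>\<sigma>. 0)"
  by (rule ext) (simp add: sboundary_def)

lemma schain_carrier: "c \<in> carrier (schain_group p K L) \<longleftrightarrow> (\<forall>\<sigma>. c \<sigma> \<noteq> 0 \<longrightarrow> \<sigma> \<in> K - L \<and> int (card \<sigma>) = p + 1)"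
  by (simp add: schain_group_def)

lemma zero_in_schain: "(\<lambda>_. 0) \<in> carrier (schain_group p K L)"
  by (simp add: schain_carrier)

lemma trivial_aug_homology_imp_boundary:
  assumes "trivial_group (aug_homology p K L)" "c \<in> scycles p K L"
  shows "c \<in> sboundaries p K L"
proof -
  let ?Z = "(schain_group p K L)\<lparr>carrier := scycles p K L\<rparr>" and ?B = "sboundaries p K L"
  have "?B #>\<^bsub>?Z\<^esub> c \<in> carrier (aug_homology p K L)"
    using assms(2) by (auto simp: aug_homology_def FactGroup_def RCOSETS_def)
  then have "?B #>\<^bsub>?Z\<^esub> c = ?B"
    using assms(1) by (simp add: trivial_group_def aug_homology_def FactGroup_def)
  moreover have "(\<lambda>_. 0) \<in> ?B"
    unfolding sboundaries_def by (rule image_eqI[OF _ zero_in_schain]) (simp add: sboundary_zero)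
  then have "c \<in> ?B #>\<^bsub>?Z\<^esub> c"
    unfolding r_coset_def by (intro UN_I[of "\<lambda>_. 0"]) (simp_all add: schain_group_def)
  ultimately show ?thesis by simp
qed

text \<open>The universal coefficient correction again, now inside the simplicial complex: half the
  boundary of an integral lift is a cycle one degree lower and bounds by the reduced homology of
  \<open>K\<close>.\<close>

lemma acyclic_empty_simplex:
  fixes K :: "'v::linorder set set"
  assumes K: "simplicial_complex K" "finite K" and k: "k \<le> n"
    and H: "\<And>i. i \<noteq> int n \<Longrightarrow> trivial_group (aug_homology i K {})"
    and cyc: "\<And>\<tau>. \<lbrakk>\<tau> \<in> K; Suc (card \<tau>) = k\<rbrakk> \<Longrightarrow> bdry2 K z \<tau> = 0"
  shows "\<exists>u. \<forall>\<tau>\<in>cofaces K {} k. bdry2 K u \<tau> = z \<tau>"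
proof -
  define i where "i = int k - 1"
  have i: "i \<noteq> int n" "i - 1 \<noteq> int n" using k by (auto simp: i_def)
  define c :: "'v set \<Rightarrow> int" where "c \<tau> = of_bool (\<tau> \<in> K \<and> card \<tau> = k \<and> z \<tau> = 1)" for \<tau>
  have c: "of_int (c \<tau>) = z \<tau>" if "\<tau> \<in> K" "card \<tau> = k" for \<tau> using that by (cases "z \<tau>") (auto simp: c_def)
  have card_insert: "card (insert v \<tau>) = Suc (card \<tau>)" if "v \<in> cofvs K \<tau>" for v \<tau>
  proof -
    have "finite \<tau>" using that K simplicial_complex_finite[of K "insert v \<tau>"] by (simp add: cofvs_def)
    then show ?thesis using that by (simp add: cofvs_def)
  qed
  have bc0: "sboundary K {} c \<tau> = 0" if "Suc (card \<tau>) \<noteq> k" for \<tau>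
    using that card_insert by (auto simp: sboundary_void c_def intro!: sum.neutral)
  have even: "even (sboundary K {} c \<tau>)" for \<tau>
  proof (cases "\<tau> \<in> K \<and> Suc (card \<tau>) = k")
    case True
    have "bdry2 K (\<lambda>\<rho>. of_int (c \<rho>)) \<tau> = bdry2 K z \<tau>"
      unfolding bdry2_def using True card_insert by (intro sum.cong c) (auto simp: cofvs_def)
    then have "of_int (sboundary K {} c \<tau>) = (0::bit)" using bdry2_of_int[of \<tau> K c] cyc True by simp
    then show ?thesis by (simp add: bit_of_int)
  next
    case False
    then have "sboundary K {} c \<tau> = 0" using bc0[of \<tau>] by (cases "\<tau> \<in> K") (simp_all add: sboundary_def)
    then show ?thesis by simp
  qed
  define b where "b \<tau> = sboundary K {} c \<tau> div 2" for \<tau>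
  have b2: "sboundary K {} c = (\<lambda>\<tau>. 2 * b \<tau>)" using even by (auto simp: b_def)
  have "b \<tau> = 0" if "Suc (card \<tau>) \<noteq> k \<or> \<tau> \<notin> K" for \<tau>
  proof -
    have "sboundary K {} c \<tau> = 0" using that bc0[of \<tau>] by (cases "\<tau> \<in> K") (simp_all add: sboundary_def)
    then show ?thesis by (simp add: b_def)
  qed
  then have bcar: "b \<in> carrier (schain_group (i - 1) K {})"
    unfolding schain_carrier i_def by fastforce
  have "(\<lambda>\<tau>. 2 * sboundary K {} b \<tau>) = (\<lambda>_. 0)"
    using sboundary_sboundary[OF K, of c] unfolding b2 sboundary_cmul .
  then have "sboundary K {} b = (\<lambda>_. 0)" by (metis (no_types) mult_eq_0_iff zero_neq_numeral ext)
  then have "b \<in> scycles (i - 1) K {}" using bcar by (simp add: scycles_def)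
  then have "b \<in> sboundaries (i - 1) K {}" using trivial_aug_homology_imp_boundary H i by blast
  then obtain e where e: "e \<in> carrier (schain_group i K {})" "b = sboundary K {} e"
    by (auto simp: sboundaries_def)
  \<comment> \<open>The boundary of \<open>e\<close> is half that of \<open>c\<close>, so
    \<open>d\<close> is an integral cycle congruent to \<open>c\<close> mod 2.\<close>
  define d where "d \<tau> = c \<tau> + (-2) * e \<tau>" for \<tau>
  have "c \<in> carrier (schain_group i K {})" by (auto simp: schain_carrier c_def i_def)
  then have "d \<in> carrier (schain_group i K {})"
    using e(1) unfolding schain_carrier d_def by (metis add_0 mult_zero_right)
  moreover have "sboundary K {} d = (\<lambda>_. 0)"
    unfolding d_def sboundary_add sboundary_cmul b2 e(2) by simp
  ultimately have "d \<in> scycles i K {}" by (simp add: scycles_def)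
  then have "d \<in> sboundaries i K {}" using trivial_aug_homology_imp_boundary H i by blast
  then obtain u where u: "d = sboundary K {} u" by (auto simp: sboundaries_def)
  have "bdry2 K (\<lambda>\<rho>. of_int (u \<rho>)) \<tau> = z \<tau>" if "\<tau> \<in> cofaces K {} k" for \<tau>
  proof -
    have \<tau>: "\<tau> \<in> K" "card \<tau> = k" using that by (auto simp: cofaces_def)
    have "bdry2 K (\<lambda>\<rho>. of_int (u \<rho>)) \<tau> = of_int (d \<tau>)" using bdry2_of_int[OF \<tau>(1)] u by metis
    also have "\<dots> = of_int (c \<tau>)" by (simp add: d_def)
    also have "\<dots> = z \<tau>" using c \<tau> by simp
    finally show ?thesis .
  qed
  then show ?thesis by blast
qed

section \<open>The pseudomanifold conditions\<close>

text \<open>In dimension 0 the barycentric coordinate at \<open>a\<close> takes only the values 0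
  and 1, so connectedness forbids a second vertex. This bounds the cofaces of the empty
  ridge.\<close>

lemma connected_vertices_subsingleton:
  fixes K :: "'v set set"
  assumes K: "simplicial_complex K" and con: "connected_space (realtop K)"
    and dim: "\<And>\<tau>. \<tau> \<in> K \<Longrightarrow> card \<tau> \<le> 1" and ab: "{a} \<in> K" "{b} \<in> K"
  shows "a = b"
proof (rule ccontr)
  assume ne: "a \<noteq> b"
  let ?f = "\<lambda>y::'v \<Rightarrow> real. y a"
  have "connectedin euclideanreal (?f ` realization K)"
    using connectedin_continuous_map_image[OF continuous_map_realtop_coord, of K "realization K" a] con
    by (metis connectedin_topspace topspace_realtop)
  then have con': "is_interval (?f ` realization K)" by (simp add: is_interval_connected_1)
  have bK: "barycenter {a} \<in> realization K" "barycenter {b} \<in> realization K"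
    using barycenter_in_realization K ab by blast+
  have "1 \<in> ?f ` realization K" "0 \<in> ?f ` realization K"
    using ne by (simp_all add: barycenter_def rev_image_eqI[OF bK(1)] rev_image_eqI[OF bK(2)])
  then have "1/2 \<in> ?f ` realization K"
    using con' unfolding is_interval_1 by (metis divide_le_eq_1_pos half_gt_zero_iff less_eq_real_def one_le_numeral zero_less_numeral zero_less_one)
  then obtain y where y: "y \<in> realization K" "y a = 1/2" by force
  have f: "finite {v. y v \<noteq> 0}" "card {v. y v \<noteq> 0} \<le> 1"
    using realizationD(2)[OF y(1)] K simplicial_complex_finite dim by blast+
  have "a \<in> {v. y v \<noteq> 0}" using y by simp
  then have "{v. y v \<noteq> 0} = {a}" using f by (metis card_le_Suc0_iff_eq One_nat_def singletonI is_singletonI' is_singleton_def empty_iff singletonD)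
  then show False using realizationD(3)[OF y(1)] y(2) by simp
qed

lemma CM_manifold_pseudomanifold:
  fixes K :: "'v::linorder set set"
  assumes K: "simplicial_complex K" "finite K" and CM: "CM K" and M: "homology_manifold K"
  obtains n where "sdim K = int n" "mod2_pseudomanifold K n" "K \<noteq> {}"
proof -
  \<comment> \<open>The support of this point is a nonempty simplex; it rules out \<open>{}\<close>
    and \<open>{{}}\<close> and makes the dimension nonnegative.\<close>
  obtain x where x: "x \<in> realization K" using CM by (auto simp: CM_def)
  let ?s = "{v. x v \<noteq> 0}"
  have s: "?s \<in> K" "finite ?s" "?s \<noteq> {}"
  proof -
    show "?s \<in> K" by (rule realizationD(2)[OF x])
    then show "finite ?s" using K simplicial_complex_finite by blast
    show "?s \<noteq> {}"
    proof
      assume "?s = {}"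
      then show False using realizationD(3)[OF x] by (simp only: sum.empty zero_neq_one)
    qed
  qed
  define N where "N = Max (card ` K)"
  have N: "card \<tau> \<le> N" if "\<tau> \<in> K" for \<tau> unfolding N_def using that K by simp
  have "card ?s > 0" using s by (simp add: card_gt_0_iff)
  then have "N > 0" using N[OF s(1)] by linarith
  then obtain n where n: "N = Suc n" by (cases N) auto
  then have sd: "sdim K = int n" by (simp add: sdim_def N_def)
  have dim: "card \<tau> \<le> Suc n" if "\<tau> \<in> K" for \<tau> using N[OF that] n by simp
  have loc: "trivial_group (local_homology (int q) K (barycenter \<sigma>))" if "\<sigma> \<in> K" "\<sigma> \<noteq> {}" "q < n" for \<sigma> q
    using CM barycenter_in_realization[OF K(1) that(1,2)] sd that(3) by (auto simp: CM_def)
  have acyc: "\<exists>u. \<forall>\<tau>\<in>cofaces K \<sigma> k. bdry2 K u \<tau> = z \<tau>"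
    if \<sigma>: "\<sigma> \<in> K" and k: "k \<le> n" and z: "\<And>\<tau>. \<lbrakk>\<tau> \<in> K; \<sigma> \<subseteq> \<tau>; Suc (card \<tau>) = k\<rbrakk> \<Longrightarrow> bdry2 K z \<tau> = 0" for \<sigma> k z
  proof (cases "\<sigma> = {}")
    case True
    show ?thesis unfolding True
    proof (rule acyclic_empty_simplex[OF K k])
      show "trivial_group (aug_homology i K {})" if "i \<noteq> int n" for i using CM that sd by (simp add: CM_def)
      show "bdry2 K z \<tau> = 0" if "\<tau> \<in> K" "Suc (card \<tau>) = k" for \<tau> using z that True by simp
    qed
  next
    case False
    show ?thesis by (rule local_acyclic[OF K \<sigma> False k]) (use loc \<sigma> False z in auto)
  qed
  have ridge: "card (cofvs K R) \<le> 2" if R: "R \<in> K" "card R = n" for R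
  proof -
    consider "\<exists>a b. a \<noteq> b \<and> K = {{}, {a}, {b}}"
      | "connected_space (realtop K)" "\<forall>x\<in>realization K. trivial_group (local_homology (int n) K x) \<or>
           local_homology (int n) K x \<cong> integer_group"
      using M s by (auto simp: homology_manifold_def sd)
    then show ?thesis
    proof cases
      case 1
      then obtain a b where ab: "a \<noteq> b" "K = {{}, {a}, {b}}" by blast
      then have "N = 1" by (auto simp: N_def)
      then have "R = {}" using R ab n by auto
      then have "cofvs K R \<subseteq> {a,b}" using ab by (auto simp: cofvs_def)
      then show ?thesis using card_mono[of "{a,b}"] ab by (metis card_2_iff finite.emptyI finite.insertI)
    next
      case 2
      show ?thesis
      proof (cases "R = {}")
        case True
        then have "n = 0" using R by simp
        then have "a = b" if "a \<in> cofvs K R" "b \<in> cofvs K R" for a b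
          using connected_vertices_subsingleton[OF K(1) 2(1)] dim that True by (auto simp: cofvs_def)
        then have "card (cofvs K R) \<le> 1" using finite_cofvs[OF K] by (simp add: card_le_Suc0_iff_eq)
        then show ?thesis by simp
      next
        case False
        have "barycenter R \<in> realization K" using barycenter_in_realization K(1) R(1) False by blast
        then show ?thesis using ridge_bound[OF K dim R False loc] 2(2) R False by blast
      qed
    qed
  qed
  have "mod2_pseudomanifold K n"
    by unfold_locales (use K dim acyc ridge in auto)
  then show ?thesis using that sd s(1) by blast
qed

section \<open>Orientability\<close>

text \<open>With no boundaries in the top degree, homology there is the group of cycles, and both
  the boundary complex and orientability become statements about cycles.\<close>

lemma top_dimensional_boundaries:
  assumes "\<And>\<tau>. \<tau> \<in> K \<Longrightarrow> card \<tau> \<le> Suc n"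
  shows "sboundaries (int n) K L = {\<lambda>_. 0}"
proof -
  have "carrier (schain_group (int n + 1) K L) = {\<lambda>_. 0}"
    using assms by (fastforce simp: schain_group_def)
  then show ?thesis by (simp add: sboundaries_def sboundary_zero)
qed

lemma group_scycles: "group ((schain_group p K L)\<lparr>carrier := scycles p K L\<rparr>)"
proof (rule groupI)
  let ?G = "(schain_group p K L)\<lparr>carrier := scycles p K L\<rparr>"
  show "x \<otimes>\<^bsub>?G\<^esub> y \<in> carrier ?G" if "x \<in> carrier ?G" "y \<in> carrier ?G" for x y
  proof -
    have xy: "x \<in> scycles p K L" "y \<in> scycles p K L" using that by simp_all
    then have "(\<lambda>\<sigma>. x \<sigma> + y \<sigma>) \<in> carrier (schain_group p K L)"
      unfolding scycles_def mem_Collect_eq schain_carrier by (metis add_0)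
    then have "(\<lambda>\<sigma>. x \<sigma> + y \<sigma>) \<in> scycles p K L"
      using xy by (simp add: scycles_def sboundary_add)
    then show ?thesis by (simp add: schain_group_def)
  qed
  show "\<one>\<^bsub>?G\<^esub> \<in> carrier ?G" by (simp add: scycles_def sboundary_zero schain_group_def)
  show "\<exists>y\<in>carrier ?G. y \<otimes>\<^bsub>?G\<^esub> x = \<one>\<^bsub>?G\<^esub>" if "x \<in> carrier ?G" for x
    using that sboundary_cmul[of K L "-1" x]
    by (intro bexI[of _ "\<lambda>\<sigma>. - 1 * x \<sigma>"]) (auto simp: scycles_def schain_group_def)
qed (auto simp: schain_group_def add.assoc)

lemma group_aug_homology_top:
  assumes "\<And>\<tau>. \<tau> \<in> K \<Longrightarrow> card \<tau> \<le> Suc n" shows "group (aug_homology (int n) K L)"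
proof -
  let ?G = "(schain_group (int n) K L)\<lparr>carrier := scycles (int n) K L\<rparr>"
  have "group (?G Mod {\<one>\<^bsub>?G\<^esub>})"
    by (intro normal.factorgroup_is_group group.one_is_normal group_scycles)
  moreover have "{\<one>\<^bsub>?G\<^esub>} = sboundaries (int n) K L"
    by (simp add: top_dimensional_boundaries[OF assms]) (simp add: schain_group_def)
  ultimately show ?thesis unfolding aug_homology_def by simp
qed

lemma aug_homology_top_iso:
  assumes "\<And>\<tau>. \<tau> \<in> K \<Longrightarrow> card \<tau> \<le> Suc n"
  shows "aug_homology (int n) K L \<cong> (schain_group (int n) K L)\<lparr>carrier := scycles (int n) K L\<rparr>"
proof -
  let ?G = "(schain_group (int n) K L)\<lparr>carrier := scycles (int n) K L\<rparr>"
  have "the_elem \<in> iso (?G Mod {\<one>\<^bsub>?G\<^esub>}) ?G" by (rule group.trivial_factor_iso[OF group_scycles])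
  moreover have "{\<one>\<^bsub>?G\<^esub>} = sboundaries (int n) K L"
    by (simp add: top_dimensional_boundaries[OF assms]) (simp add: schain_group_def)
  ultimately show ?thesis unfolding aug_homology_def is_iso_def by auto
qed

section \<open>The boundary complex and the relative fundamental cycle\<close>

context mod2_pseudomanifold
begin

lemma in_sboundary_complex_iff:
  assumes "\<sigma> \<in> K" "sdim K = int n"
  shows "\<sigma> \<in> sboundary_complex K \<longleftrightarrow> scycles (int n) K (cost K \<sigma>) = {\<lambda>_. 0}"
proof -
  let ?G = "(schain_group (int n) K (cost K \<sigma>))\<lparr>carrier := scycles (int n) K (cost K \<sigma>)\<rparr>"
  have "trivial_group (aug_homology (int n) K (cost K \<sigma>)) \<longleftrightarrow> trivial_group ?G"
    by (intro isomorphic_group_triviality aug_homology_top_iso group_aug_homology_top group_scycles card_le)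
  also have "\<dots> \<longleftrightarrow> scycles (int n) K (cost K \<sigma>) = {\<lambda>_. 0}"
    using group_scycles by (auto simp: trivial_group_def) (simp_all add: schain_group_def)
  finally show ?thesis using assms by (simp add: sboundary_complex_def)
qed

text \<open>The condition on \<open>L\<close> lets the relative boundary at a ridge run over all of
  \<open>cofvs\<close>. It holds for \<open>cost K \<sigma>\<close> by closure under passing to
  cofaces outside it, and for \<open>sboundary_complex K\<close> because that contains no
  facet.\<close>

lemma scycles_top_iff:
  assumes L: "\<And>R v. \<lbrakk>R \<in> K - L; card R = n; v \<in> cofvs K R\<rbrakk> \<Longrightarrow> insert v R \<notin> L"
  shows "c \<in> scycles (int n) K L \<longleftrightarrow>
    (\<forall>\<sigma>. c \<sigma> \<noteq> 0 \<longrightarrow> \<sigma> \<in> K - L \<and> card \<sigma> = Suc n) \<and>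
    (\<forall>R\<in>K-L. card R = n \<longrightarrow> (\<Sum>v\<in>cofvs K R. (-1) ^ card {w\<in>R. w < v} * c (insert v R)) = 0)"
    (is "_ \<longleftrightarrow> ?supp \<and> ?cyc")
proof -
  have car: "c \<in> carrier (schain_group (int n) K L) \<longleftrightarrow> ?supp" by (auto simp: schain_carrier)
  have "sboundary K L c = (\<lambda>_. 0) \<longleftrightarrow> ?cyc" if supp: ?supp
  proof -
    have ridge_eq: "sboundary K L c R = (\<Sum>v\<in>cofvs K R. (-1) ^ card {w\<in>R. w < v} * c (insert v R))"
      if "R \<in> K - L" "card R = n" for R
    proof -
      have "{v. v \<notin> R \<and> insert v R \<in> K - L} = cofvs K R" using L[OF that] by (auto simp: cofvs_def)
      then show ?thesis using that by (simp add: sboundary_def)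
    qed
    have other: "sboundary K L c \<tau> = 0" if "\<not> (\<tau> \<in> K - L \<and> card \<tau> = n)" for \<tau>
    proof (cases "\<tau> \<in> K - L")
      case True
      have "c (insert v \<tau>) = 0" if "v \<notin> \<tau>" for v
      proof -
        have "card (insert v \<tau>) \<noteq> Suc n" using True \<open>\<not> (\<tau> \<in> K - L \<and> card \<tau> = n)\<close> that finite_simplex[of \<tau>] by simp
        then show ?thesis using supp by blast
      qed
      then show ?thesis by (simp add: sboundary_def)
    next
      case False
      then show ?thesis by (simp only: sboundary_def if_False)
    qed
    show ?thesis
    proof
      assume eq: "sboundary K L c = (\<lambda>_. 0)"
      show ?cyc
      proof (intro ballI impI)
        fix R assume "R \<in> K - L" "card R = n"
        from ridge_eq[OF this] show "(\<Sum>v\<in>cofvs K R. (-1) ^ card {w\<in>R. w < v} * c (insert v R)) = 0"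
          by (simp only: eq)
      qed
    next
      assume cyc: ?cyc
      show "sboundary K L c = (\<lambda>_. 0)"
      proof
        fix \<tau> show "sboundary K L c \<tau> = 0"
        proof (cases "\<tau> \<in> K - L \<and> card \<tau> = n")
          case True
          then show ?thesis using ridge_eq[of \<tau>] cyc by simp
        qed (rule other)
      qed
    qed
  qed
  then show ?thesis using car unfolding scycles_def by blast
qed

lemma cost_open: "R \<in> K - cost K \<sigma> \<Longrightarrow> card R = n \<Longrightarrow> v \<in> cofvs K R \<Longrightarrow> insert v R \<notin> cost K \<sigma>"
  by (auto simp: cost_def)

text \<open>All proper faces of \<open>F\<close> lie in its cost, so \<open>F\<close> alone is a
  nonzero relative cycle.\<close>

lemma facet_not_in_sboundary_complex:
  assumes F: "F \<in> K" "card F = Suc n" and sd: "sdim K = int n"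
  shows "F \<notin> sboundary_complex K"
proof -
  define c :: "'v set \<Rightarrow> int" where "c \<sigma> = of_bool (\<sigma> = F)" for \<sigma>
  have "c \<in> scycles (int n) K (cost K F)"
  proof (subst scycles_top_iff[OF cost_open], assumption+, intro conjI ballI impI allI)
    fix R assume "R \<in> K - cost K F" "card R = n"
    then have "F \<subseteq> R" "finite R" using finite_simplex by (auto simp: cost_def)
    then have "card F \<le> card R" by (intro card_mono)
    then show "(\<Sum>v\<in>cofvs K R. (-1) ^ card {w\<in>R. w < v} * c (insert v R)) = 0"
      using F \<open>card R = n\<close> by simp
  qed (use F in \<open>auto simp: c_def cost_def\<close>)
  moreover have "c \<noteq> (\<lambda>_. 0)" by (auto simp: c_def fun_eq_iff)
  ultimately show ?thesis using in_sboundary_complex_iff[OF F(1) sd] by auto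
qed

text \<open>Relative to the cost of \<open>R\<close> a top cycle is one linear equation with
  coefficients 1 or -1, in one unknown per facet on \<open>R\<close>. With one unknown only zero
  solves it; with two there is a nonzero solution.\<close>

lemma ridge_in_sboundary_complex_iff:
  assumes R: "R \<in> K" "card R = n" and sd: "sdim K = int n"
  shows "R \<in> sboundary_complex K \<longleftrightarrow> card (cofvs K R) = 1"
proof -
  let ?s = "\<lambda>R v. (-1::int) ^ card {w\<in>R. w < v}"
  have fR: "finite R" using R finite_simplex by blast
  have only: "R' = R" if "R' \<in> K - cost K R" "card R' = n" for R'
    using that R coface_card_eq[of R' R] by (auto simp: cost_def)
  have iff: "c \<in> scycles (int n) K (cost K R) \<longleftrightarrow>
    (\<forall>\<sigma>. c \<sigma> \<noteq> 0 \<longrightarrow> \<sigma> \<in> K - cost K R \<and> card \<sigma> = Suc n) \<and> (\<Sum>v\<in>cofvs K R. ?s R v * c (insert v R)) = 0" for c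
  proof -
    have "R \<in> K - cost K R" using R by (simp add: cost_def)
    then have "(\<forall>R'\<in>K - cost K R. card R' = n \<longrightarrow> P R') \<longleftrightarrow> P R" for P using only R(2) by metis
    then show ?thesis by (simp only: scycles_top_iff[OF cost_open])
  qed
  have ne: "cofvs K R \<noteq> {}" and fin': "finite (cofvs K R)"
    using ridge_cofvs_nonempty R finite_cofvs[OF complex fin] by auto
  have "card (cofvs K R) \<le> 2" using ridge R by blast
  moreover have "card (cofvs K R) > 0" using ne fin' by (simp add: card_gt_0_iff)
  ultimately consider "card (cofvs K R) = 1" | "card (cofvs K R) = 2" by linarith
  then show ?thesis
  proof cases
    case 1
    then obtain v where v: "cofvs K R = {v}" by (meson card_1_singletonE)
    have "c = (\<lambda>_. 0)" if "c \<in> scycles (int n) K (cost K R)" for c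
    proof
      fix \<sigma>
      have c0: "c (insert v R) = 0" using that v by (simp add: iff)
      show "c \<sigma> = 0"
      proof (rule ccontr)
        assume nz: "c \<sigma> \<noteq> 0"
        then have "\<sigma> \<in> K - cost K R \<and> card \<sigma> = Suc n" using that unfolding iff by blast
        then have \<sigma>: "\<sigma> \<in> K" "R \<subseteq> \<sigma>" "card \<sigma> = Suc n" by (auto simp: cost_def)
        then have "card (\<sigma> - R) = 1" using R fR by (simp add: card_Diff_subset)
        then obtain x where x: "\<sigma> - R = {x}" by (meson card_1_singletonE)
        then have x': "\<sigma> = insert x R" "x \<notin> R" using \<sigma>(2) by auto
        then have "x \<in> cofvs K R" using \<sigma>(1) by (simp add: cofvs_def)
        then show False using v c0 nz x' by simp
      qed
    qed
    moreover have "(\<lambda>_. 0) \<in> scycles (int n) K (cost K R)" by (simp add: iff)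
    ultimately show ?thesis using in_sboundary_complex_iff[OF R(1) sd] 1 by blast
  next
    case 2
    then obtain v w where vw: "cofvs K R = {v,w}" "v \<noteq> w" by (meson card_2_iff)
    then have vR: "v \<notin> R" "w \<notin> R" "insert v R \<in> K" "insert w R \<in> K" by (auto simp: cofvs_def)
    have ins: "insert w R \<noteq> insert v R" using vR vw by auto
    define c where "c \<sigma> = (if \<sigma> = insert v R then ?s R v else if \<sigma> = insert w R then - ?s R w else 0)" for \<sigma>
    have "c \<in> scycles (int n) K (cost K R)" unfolding iff
    proof (intro conjI allI impI)
      fix \<sigma> assume "c \<sigma> \<noteq> 0"
      then have "\<sigma> = insert v R \<or> \<sigma> = insert w R" by (auto simp: c_def split: if_splits)
      then show "\<sigma> \<in> K - cost K R" "card \<sigma> = Suc n" using vR fR R by (auto simp: cost_def)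
    qed (use vw ins in \<open>simp add: c_def power_mult_distrib[symmetric]\<close>)
    moreover have "c (insert v R) \<noteq> 0" by (simp add: c_def)
    ultimately show ?thesis using in_sboundary_complex_iff[OF R(1) sd] 2 by auto
  qed
qed

lemma sign_eq: "(-1::int) ^ card {w\<in>R. w < v} = (if vpos R v = 0 then 1 else -1)"
  by (simp add: vpos_def bit_of_nat minus_one_power_iff)

lemma orientable:
  assumes ne: "K \<noteq> {}" and sd: "sdim K = int n"
  shows "orientable K"
proof -
  let ?B = "sboundary_complex K"
  let ?s = "\<lambda>R v. (-1::int) ^ card {w\<in>R. w < v}"
  let ?G = "(schain_group (int n) K ?B)\<lparr>carrier := scycles (int n) K ?B\<rparr>"
  have e: "{} \<in> K" using ne face by blast
  obtain \<epsilon> where \<epsilon>: "coherent K n {} \<epsilon>" using coherent_exists[OF e] by auto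
  have facet: "F \<notin> ?B" if "F \<in> K" "card F = Suc n" for F using facet_not_in_sboundary_complex that sd by blast
  have cofv: "insert v R \<in> K" "card (insert v R) = Suc n" if "R \<in> K" "card R = n" "v \<in> cofvs K R" for R v
    using that finite_simplex by (auto simp: cofvs_def)
  have interior: "R \<in> ?B \<longleftrightarrow> card (cofvs K R) = 1" if "R \<in> K" "card R = n" for R
    using ridge_in_sboundary_complex_iff that sd by blast
  have iff: "c \<in> scycles (int n) K ?B \<longleftrightarrow>
    (\<forall>\<sigma>. c \<sigma> \<noteq> 0 \<longrightarrow> \<sigma> \<in> K - ?B \<and> card \<sigma> = Suc n) \<and>
    (\<forall>R\<in>K-?B. card R = n \<longrightarrow> (\<Sum>v\<in>cofvs K R. ?s R v * c (insert v R)) = 0)" for c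
    by (rule scycles_top_iff) (use facet cofv in auto)
  define c0 :: "'v set \<Rightarrow> int" where
    "c0 F = (if F \<in> K \<and> card F = Suc n then if \<epsilon> F = 0 then 1 else -1 else 0)" for F
  have pair: "?s R v * c0 (insert v R) + ?s R w * c0 (insert w R) = 0"
    if R: "R \<in> K" "card R = n" and vw: "v \<in> cofvs K R" "w \<in> cofvs K R" "v \<noteq> w" for R v w
  proof -
    have "\<epsilon> (insert v R) + \<epsilon> (insert w R) = 1 + vpos R v + vpos R w"
      using \<epsilon> R vw by (simp add: coherent_def cofaces_def)
    then show ?thesis
      using cofv[OF R vw(1)] cofv[OF R vw(2)] unfolding sign_eq c0_def
      by (cases "\<epsilon> (insert v R)"; cases "\<epsilon> (insert w R)"; cases "vpos R v"; cases "vpos R w") auto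
  qed
  have "\<sigma> \<in> K - ?B \<and> card \<sigma> = Suc n" if "c0 \<sigma> \<noteq> 0" for \<sigma>
  proof -
    have "\<sigma> \<in> K \<and> card \<sigma> = Suc n" using that unfolding c0_def by argo
    then show ?thesis using facet by blast
  qed
  \<comment> \<open>Off the boundary complex a ridge does not have exactly one facet, by purity it
    has at least one, and so it has two, where coherence applies.\<close>
  moreover have "(\<Sum>v\<in>cofvs K R. ?s R v * c0 (insert v R)) = 0" if R: "R \<in> K - ?B" "card R = n" for R
  proof -
    have "card (cofvs K R) \<noteq> 1" using R interior by blast
    moreover have "card (cofvs K R) \<noteq> 0"
      using ridge_cofvs_nonempty[of R] R finite_cofvs[OF complex fin] by simp
    moreover have "card (cofvs K R) \<le> 2" using ridge R by blast
    ultimately have "card (cofvs K R) = 2" by linarith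
    then obtain v w where vw: "cofvs K R = {v,w}" "v \<noteq> w" by (meson card_2_iff)
    then show ?thesis using pair[of R v w] R by simp
  qed
  ultimately have c0: "c0 \<in> scycles (int n) K ?B" using iff[of c0] by blast
  obtain F0 where F0: "F0 \<in> cofaces K {} (Suc n)" using facet_exists[OF e] by blast
  have unit: "c0 F * c0 F = 1" if "F \<in> cofaces K {} (Suc n)" for F using that by (auto simp: c0_def cofaces_def)
  \<comment> \<open>Since \<open>c0\<close> is 1 or -1 on facets, the product
    \<open>c F * c0 F\<close> is the quotient of the two cycles. Across a ridge both factors keep or
    both change their sign, so the quotient is constant by strong connectedness.\<close>
  have multiple: "c = (\<lambda>\<sigma>. (c F0 * c0 F0) * c0 \<sigma>)" if c: "c \<in> scycles (int n) K ?B" for c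
  proof
    fix F
    show "c F = (c F0 * c0 F0) * c0 F"
    proof (cases "F \<in> cofaces K {} (Suc n)")
      case True
      have "c F * c0 F = c F0 * c0 F0"
      proof (rule facets_constant[OF e _ True F0])
        fix F F' assume F: "F \<in> cofaces K {} (Suc n)" "F' \<in> cofaces K {} (Suc n)" "card (F \<inter> F') = n"
        let ?R = "F \<inter> F'"
        have F': "F \<in> K" "F' \<in> K" "card F = Suc n" "card F' = Suc n" "finite F" "finite F'"
          using F finite_simplex by (auto simp: cofaces_def)
        have R: "?R \<in> K" "card ?R = n" using F'(1) face[of F ?R] F(3) by simp_all
        have "card (F - ?R) = 1" "card (F' - ?R) = 1"
          using F' F(3) card_Diff_subset[of ?R F] card_Diff_subset[of ?R F'] by auto
        then obtain v w where v: "F - ?R = {v}" and w: "F' - ?R = {w}" by (metis card_1_singletonE)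
        then have vw: "insert v ?R = F" "insert w ?R = F'" "v \<notin> ?R" "w \<notin> ?R" "v \<noteq> w" by auto
        then have A: "v \<in> cofvs K ?R" "w \<in> cofvs K ?R" using F' unfolding cofvs_def by simp_all
        have two: "cofvs K ?R = {v,w}" by (rule cofvs_eq[OF R A vw(5)])
        \<comment> \<open>A ridge shared by two facets is never in the boundary complex, so the
          cycle condition is available at every crossing.\<close>
        then have "card (cofvs K ?R) \<noteq> 1" using vw(5) by simp
        then have "?R \<in> K - ?B" using R interior by blast
        then have "(\<Sum>x\<in>cofvs K ?R. ?s ?R x * c (insert x ?R)) = 0" using c R unfolding iff by blast
        then have 1: "?s ?R v * c F + ?s ?R w * c F' = 0" unfolding two using vw(1,2,5) by simp
        have 2: "?s ?R v * c0 F + ?s ?R w * c0 F' = 0" using pair[OF R A vw(5)] by (simp only: vw(1,2))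
        have "c F' = c F \<and> c0 F' = c0 F \<or> c F' = - c F \<and> c0 F' = - c0 F"
          using 1 2 unfolding sign_eq by (simp split: if_splits; linarith)
        then show "c F * c0 F = c F' * c0 F'" by auto
      qed
      then show ?thesis using unit[OF True] by (metis mult.assoc mult.right_neutral)
    next
      case False
      then have "c F = 0" "c0 F = 0" using c unfolding iff by (auto simp: cofaces_def c0_def)
      then show ?thesis by simp
    qed
  qed
  have "(\<lambda>m \<sigma>. m * c0 \<sigma>) \<in> iso integer_group ?G"
  proof (rule isoI)
    show "(\<lambda>m \<sigma>. m * c0 \<sigma>) \<in> hom integer_group ?G"
    proof (rule homI)
      fix m :: int
      have "(\<lambda>\<sigma>. m * c0 \<sigma>) \<in> carrier (schain_group (int n) K ?B)"
        using c0 unfolding scycles_def mem_Collect_eq schain_carrier by (metis mult_zero_right)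
      then show "(\<lambda>\<sigma>. m * c0 \<sigma>) \<in> carrier ?G"
        using c0 by (simp add: scycles_def sboundary_cmul)
    qed (simp add: schain_group_def distrib_right)
    show "bij_betw (\<lambda>m \<sigma>. m * c0 \<sigma>) (carrier integer_group) (carrier ?G)"
    proof (rule bij_betw_byWitness[where f'="\<lambda>c. c F0 * c0 F0"])
      show "\<forall>m\<in>carrier integer_group. m * c0 F0 * c0 F0 = m"
        using unit[OF F0] by (simp add: mult.assoc)
      show "\<forall>c\<in>carrier ?G. (\<lambda>\<sigma>. c F0 * c0 F0 * c0 \<sigma>) = c" using multiple by simp
      show "(\<lambda>m \<sigma>. m * c0 \<sigma>) ` carrier integer_group \<subseteq> carrier ?G"
        using \<open>(\<lambda>m \<sigma>. m * c0 \<sigma>) \<in> hom integer_group ?G\<close> by (auto simp: hom_def)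
    qed simp
  qed
  then have "integer_group \<cong> ?G" unfolding is_iso_def by blast
  then have "?G \<cong> integer_group" by (rule group.iso_sym[OF group_integer_group])
  with aug_homology_top_iso[OF card_le] show ?thesis
    unfolding orientable_def sd by (rule iso_trans)
qed

end

theorem theorem14:
  fixes K :: "'v::linorder set set"
  assumes "simplicial_complex K" and "finite K"
    and "CM K" and "homology_manifold K"
  shows "orientable K"
proof -
  obtain n where "sdim K = int n" "mod2_pseudomanifold K n" "K \<noteq> {}"
    using CM_manifold_pseudomanifold[OF assms] by blast
  then show ?thesis using mod2_pseudomanifold.orientable by blast
qed

end
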